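(* Let $(X,d)$ be a compact metric space and let $f:X\to X$ be a continuous map such that the entropy function $\mu\mapsto h_\mu(f)$ is upper semi-continuous on $\mathcal{M}(f)$. Suppose that there is a continuous function $\phi:X\to\mathbb{R}$ such that: (1) for every real $t\ge 0$, the system $(X,f,t\phi)$ has a unique equilibrium state; (2) the set of maximizing measures for $\phi$ is a singleton $\{\mu_\phi\}$, and $h_{\mu_\phi}(f)=0$. Then $(X,f)$ has the intermediate entropy property, i.e. for every $a\in[0,h(f))$ there is an ergodic measure $\mu\in\mathcal{M}_e(f)$ with $h_\mu(f)=a$.
   Context: $\mathcal{M}(f)$ is the set of all $f$-invariant Borel probability measures on $X$ with the weak-$*$ topology, and $\mathcal{M}_e(f)\subset\mathcal{M}(f)$ is the subset of ergodic measures. $h_\mu(f)$ is the metric (Kolmogorov–Sinai) entropy of $f$ with respect to $\mu$, and $h(f)$ is the topological entropy of $f$. For a continuous $\phi:X\to\mathbb{R}$ and $\mu\in\mathcal{M}(f)$, the pressure of $\mu$ is $P_\mu(\phi)=h_\mu(f)+\int\phi\,d\mu$; $P(\phi)$ is the topological pressure of $(X,f,\phi)$, which by the Variational Principle equals $\sup\{P_\mu(\phi):\mu\in\mathcal{M}(f)\}$. An equilibrium state for $(X,f,\phi)$ is a measure $\mu\in\mathcal{M}(f)$ with $P_\mu(\phi)=P(\phi)$. A maximizing measure for $\phi$ is a measure $\mu\in\mathcal{M}(f)$ such that $\int\phi\,d\mu=\sup_{\nu\in\mathcal{M}(f)}\int\phi\,d\nu$. *)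

theory Defs
  imports "HOL-Probability.Probability"
begin

text \<open>
  The phase space is the whole type: a compact metric space is a type of class
  \<^class>\<open>metric_space\<close> whose universe is compact. Entropies and pressures are extended
  reals, since they may a priori be infinite.
\<close>

section \<open>Invariant and ergodic measures\<close>

definition invariant_measures :: "('a::metric_space \<Rightarrow> 'a) \<Rightarrow> 'a measure set" where
  "invariant_measures f = {\<mu>. prob_space \<mu> \<and> sets \<mu> = sets borel \<and> distr \<mu> borel f = \<mu>}"

definition ergodic_measures :: "('a::metric_space \<Rightarrow> 'a) \<Rightarrow> 'a measure set" where
  "ergodic_measures f =
     {\<mu> \<in> invariant_measures f.
        \<forall>A \<in> sets borel. f -` A = A \<longrightarrow> measure \<mu> A = 0 \<or> measure \<mu> A = 1}"

text \<open>
  The weak-* topology: the coarsest topology making integration against every continuous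
  function continuous. Its underlying space is the whole set of invariant measures (take the
  integrand to be zero).
\<close>

definition weak_star_topology :: "('a::metric_space \<Rightarrow> 'a) \<Rightarrow> 'a measure topology" where
  "weak_star_topology f = topology_generated_by
     {{\<mu> \<in> invariant_measures f. integral\<^sup>L \<mu> g \<in> U} | (g :: 'a \<Rightarrow> real) U.
        continuous_on UNIV g \<and> open U}"

definition upper_semicontinuous_map :: "'b topology \<Rightarrow> ('b \<Rightarrow> ereal) \<Rightarrow> bool" where
  "upper_semicontinuous_map T h \<longleftrightarrow> (\<forall>c. openin T {x \<in> topspace T. h x < c})"

section \<open>Metric entropy\<close>

definition borel_partition :: "'a::topological_space set set \<Rightarrow> bool" where
  "borel_partition P \<longleftrightarrow> finite P \<and> P \<subseteq> sets borel \<and> partition_on UNIV P"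

text \<open>The join of the partitions \<open>(f ^^ i) -` P\<close> for \<open>i < n\<close>.\<close>

definition iterated_join :: "('a \<Rightarrow> 'a) \<Rightarrow> 'a set set \<Rightarrow> nat \<Rightarrow> 'a set set" where
  "iterated_join f P n = {\<Inter>i<n. (f ^^ i) -` A i | A. \<forall>i<n. A i \<in> P} - {{}}"

definition partition_entropy :: "'a measure \<Rightarrow> 'a set set \<Rightarrow> real" where
  "partition_entropy \<mu> P = - (\<Sum>A\<in>P. measure \<mu> A * ln (measure \<mu> A))"

text \<open>
  For invariant measures the sequence below converges, by subadditivity, so the upper limit
  is the limit.
\<close>

definition ks_entropy_partition :: "('a \<Rightarrow> 'a) \<Rightarrow> 'a measure \<Rightarrow> 'a set set \<Rightarrow> ereal" where
  "ks_entropy_partition f \<mu> P =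
     limsup (\<lambda>n. ereal (partition_entropy \<mu> (iterated_join f P n) / real n))"

definition ks_entropy :: "('a::metric_space \<Rightarrow> 'a) \<Rightarrow> 'a measure \<Rightarrow> ereal" where
  "ks_entropy f \<mu> = (SUP P\<in>{P. borel_partition P}. ks_entropy_partition f \<mu> P)"

section \<open>Topological entropy and pressure\<close>

definition separated_sets ::
    "('a::metric_space \<Rightarrow> 'a) \<Rightarrow> nat \<Rightarrow> real \<Rightarrow> 'a set set" where
  "separated_sets f n \<epsilon> =
     {E. finite E \<and> (\<forall>x\<in>E. \<forall>y\<in>E. x \<noteq> y \<longrightarrow> (\<exists>i<n. dist ((f ^^ i) x) ((f ^^ i) y) > \<epsilon>))}"

definition birkhoff_sum :: "('a \<Rightarrow> 'a) \<Rightarrow> ('a \<Rightarrow> real) \<Rightarrow> nat \<Rightarrow> 'a \<Rightarrow> real" where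
  "birkhoff_sum f \<phi> n x = (\<Sum>i<n. \<phi> ((f ^^ i) x))"

text \<open>
  Bowen's definitions by separated sets. The growth rates increase as \<open>\<epsilon>\<close> decreases, so the
  limit as \<open>\<epsilon>\<close> tends to \<open>0\<close> is a supremum. If the space is compact and \<open>f\<close> and \<open>\<phi>\<close> are
  continuous, then the inner real suprema are over nonempty sets that are bounded above.
\<close>

definition topological_entropy :: "('a::metric_space \<Rightarrow> 'a) \<Rightarrow> ereal" where
  "topological_entropy f =
     (SUP \<epsilon>\<in>{0<..}. limsup (\<lambda>n. ereal (ln (SUP E\<in>separated_sets f n \<epsilon>. real (card E)) / real n)))"

definition topological_pressure :: "('a::metric_space \<Rightarrow> 'a) \<Rightarrow> ('a \<Rightarrow> real) \<Rightarrow> ereal" where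
  "topological_pressure f \<phi> =
     (SUP \<epsilon>\<in>{0<..}. limsup (\<lambda>n.
        ereal (ln (SUP E\<in>separated_sets f n \<epsilon>. \<Sum>x\<in>E. exp (birkhoff_sum f \<phi> n x)) / real n)))"

definition measure_pressure ::
    "('a::metric_space \<Rightarrow> 'a) \<Rightarrow> ('a \<Rightarrow> real) \<Rightarrow> 'a measure \<Rightarrow> ereal" where
  "measure_pressure f \<phi> \<mu> = ks_entropy f \<mu> + ereal (integral\<^sup>L \<mu> \<phi>)"

section \<open>Equilibrium states and maximizing measures\<close>

definition equilibrium_state ::
    "('a::metric_space \<Rightarrow> 'a) \<Rightarrow> ('a \<Rightarrow> real) \<Rightarrow> 'a measure \<Rightarrow> bool" where
  "equilibrium_state f \<phi> \<mu> \<longleftrightarrow>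
     \<mu> \<in> invariant_measures f \<and> measure_pressure f \<phi> \<mu> = topological_pressure f \<phi>"

definition maximizing_measures ::
    "('a::metric_space \<Rightarrow> 'a) \<Rightarrow> ('a \<Rightarrow> real) \<Rightarrow> 'a measure set" where
  "maximizing_measures f \<phi> =
     {\<mu> \<in> invariant_measures f. integral\<^sup>L \<mu> \<phi> = (SUP \<nu>\<in>invariant_measures f. integral\<^sup>L \<nu> \<phi>)}"

definition intermediate_entropy_property :: "('a::metric_space \<Rightarrow> 'a) \<Rightarrow> bool" where
  "intermediate_entropy_property f \<longleftrightarrow>
     (\<forall>a::real. 0 \<le> a \<and> ereal a < topological_entropy f \<longrightarrow>
        (\<exists>\<mu>\<in>ergodic_measures f. ks_entropy f \<mu> = ereal a))"

end

theory Submission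
  imports Defs
begin

text \<open>
  Let \<open>m t\<close> be the equilibrium state of \<open>t \<phi>\<close>. The measures \<open>m t\<close> for \<open>t \<ge> 0\<close> form a path of
  ergodic measures along which the entropy is continuous; it starts at a measure of maximal entropy
  and approaches \<open>\<mu>\<^sub>\<phi>\<close>, whose entropy is \<open>0\<close>. The intermediate value theorem then gives every value
  strictly between \<open>0\<close> and the topological entropy, and \<open>\<mu>\<^sub>\<phi>\<close> itself gives the value \<open>0\<close>.

  Everything rests on the inequality \<open>h\<^sub>\<mu>(f) + \<integral>\<psi> d\<mu> \<le> P(\<psi>)\<close> for invariant \<open>\<mu>\<close>
  (\<open>measure_pressure_le_topological_pressure\<close>), which turns equilibrium states into maximizers of the
  pressure of a measure; that the maximum is attained is contained in the hypothesis. The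
  inequality is proved by comparing the itineraries of typical points with a maximal separated set.
  The ambiguity of an itinerary is confined to a set of small measure, and a penalty on that set,
  added to the potential, keeps the number of itineraries under control
  (\<open>shadow_sum_le\<close>).

  Given this, let \<open>t\<^sub>n\<close> tend to \<open>t\<close>. Invariant measures are weak-* sequentially compact
  (\<open>invariant_measures_seq_compact\<close>), and \<open>P(t \<phi>)\<close> is Lipschitz in \<open>t\<close>. Upper semicontinuity of the
  entropy makes each limit of \<open>m t\<^sub>n\<close> a maximizer for \<open>t \<phi>\<close>, hence equal to \<open>m t\<close>. So
  \<open>\<integral>\<phi> d(m t)\<close> is continuous in \<open>t\<close>, and so is the entropy
  \<open>P(t \<phi>) - t \<integral>\<phi> d(m t)\<close>. For \<open>t\<close> tending to infinity, the pressure divided by \<open>t\<close> tends to the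
  maximal integral of \<open>\<phi>\<close>. The states \<open>m n\<close> therefore have a subsequence converging to a maximizing
  measure, which is \<open>\<mu>\<^sub>\<phi>\<close>, and upper semicontinuity bounds their entropies by numbers tending to \<open>0\<close>.

  Ergodicity holds because the pressure of a measure does not exceed the mixture of the pressures
  of the parts into which the measure is decomposed (\<open>ks_entropy_convex_combination_le\<close>): a unique
  maximizer is extreme, and an extreme invariant measure is ergodic
  (\<open>extreme_invariant_measure_ergodic\<close>). Finiteness of the topological entropy, needed to subtract,
  follows from concavity of the entropy and the uniqueness at \<open>t = 0\<close>: if \<open>m 0\<close> had infinite entropy,
  so would its midpoint with \<open>\<mu>\<^sub>\<phi>\<close>.
\<close>

section \<open>Coding a compact metric space by real numbers\<close>

lemma compact_fine_countable_cover:
  assumes "compact (UNIV :: 'a::metric_space set)"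
  obtains U :: "nat \<Rightarrow> 'a::metric_space set" where "\<And>i. open (U i)"
    and "\<And>e. e > 0 \<Longrightarrow> \<exists>N. \<forall>x. \<exists>i<N. x \<in> U i \<and> (\<forall>y\<in>U i. \<forall>z\<in>U i. dist y z < e)"
proof -
  have "\<forall>n::nat. \<exists>F::'a set. finite F \<and> UNIV \<subseteq> (\<Union>x\<in>F. ball x (1 / Suc n))"
    using assms unfolding compact_eq_totally_bounded by simp
  then obtain F :: "nat \<Rightarrow> 'a set" where F: "\<And>n. finite (F n)"
      "\<And>n. UNIV \<subseteq> (\<Union>x\<in>F n. ball x (1 / Suc n))"
    by metis
  define B where "B n = (\<lambda>x. ball x (1 / Suc n)) ` F n" for n
  have cnt: "countable (\<Union>n. B n)"
    by (intro countable_UN) (auto simp: B_def F intro: countable_finite)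
  have ne: "(\<Union>n. B n) \<noteq> {}"
  proof -
    have "undefined \<in> (\<Union>x\<in>F 0. ball x (1 / Suc 0))" using F(2)[of 0] by blast
    then show ?thesis unfolding B_def by blast
  qed
  define U where "U = from_nat_into (\<Union>n. B n)"
  have Uin: "U i \<in> (\<Union>n. B n)" for i
    unfolding U_def by (rule from_nat_into[OF ne])
  show thesis
  proof (rule that)
    show "open (U i)" for i
      using Uin[of i] by (auto simp: B_def)
    fix e :: real assume "e > 0"
    then obtain n where n: "1 / Suc n < e / 2"
      using nat_approx_posE[of "e/2"] by auto
    have "\<forall>b\<in>B n. \<exists>i. U i = b"
      unfolding U_def using from_nat_into_surj[OF cnt] by blast
    then obtain j where j: "\<And>b. b \<in> B n \<Longrightarrow> U (j b) = b"
      by metis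
    have fB: "finite (B n)" by (simp add: B_def F)
    show "\<exists>N. \<forall>x. \<exists>i<N. x \<in> U i \<and> (\<forall>y\<in>U i. \<forall>z\<in>U i. dist y z < e)"
    proof (rule exI[of _ "Suc (Max (j ` B n))"], rule allI)
      fix x
      obtain b where b: "b \<in> F n" "x \<in> ball b (1 / Suc n)"
        using F(2)[of n] by blast
      have "dist y z < e" if "y \<in> ball b (1 / Suc n)" "z \<in> ball b (1 / Suc n)" for y z
        using dist_triangle3[of y z b] that n by simp
      moreover have "ball b (1 / Suc n) \<in> B n"
        using b by (simp add: B_def)
      moreover have "j (ball b (1 / Suc n)) < Suc (Max (j ` B n))"
        using fB b by (simp add: less_Suc_eq_le B_def)
      ultimately show "\<exists>i<Suc (Max (j ` B n)). x \<in> U i \<and> (\<forall>y\<in>U i. \<forall>z\<in>U i. dist y z < e)"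
        using b(2) j by metis
    qed
  qed
qed

text \<open>
  Digits \<open>0\<close> and \<open>1\<close> in base \<open>3\<close> leave gaps: the first digit in which two codes differ outweighs
  all later ones together, which fails in base \<open>2\<close>.
\<close>

lemma ternary_code_separates:
  fixes d d' :: "nat \<Rightarrow> real"
  assumes d: "\<And>i. d i \<in> {0,1}" and d': "\<And>i. d' i \<in> {0,1}"
    and diff: "i < N" "d i \<noteq> d' i"
  shows "\<bar>(\<Sum>i. (1/3)^i * d i) - (\<Sum>i. (1/3)^i * d' i)\<bar> \<ge> (1/3)^N / 2"
proof -
  define e where "e i = (1/3)^i * (d i - d' i)" for i :: nat
  have sm: "summable (\<lambda>i. (1/3::real)^i * c i)" if "\<And>i. \<bar>c i\<bar> \<le> 1" for c :: "nat \<Rightarrow> real"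
  proof (rule summable_comparison_test'[OF summable_geometric[of "1/3::real"]])
    fix i show "norm ((1/3)^i * c i) \<le> (1/3)^i"
      using that[of i] by (simp add: abs_mult divide_simps)
  qed auto
  have d1: "\<bar>d i\<bar> \<le> 1" "\<bar>d' i\<bar> \<le> 1" "\<bar>d i - d' i\<bar> \<le> 1" for i
    using d[of i] d'[of i] by auto
  have eq: "(\<Sum>i. (1/3)^i * d i) - (\<Sum>i. (1/3)^i * d' i) = (\<Sum>i. e i)"
    unfolding e_def using suminf_diff[OF sm[of d] sm[of d']] d1 by (simp add: right_diff_distrib)
  define k where "k = (LEAST i. d i \<noteq> d' i)"
  have k: "d k \<noteq> d' k" "\<And>i. i < k \<Longrightarrow> d i = d' i" "k \<le> i"
  proof -
    show "d k \<noteq> d' k"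
      unfolding k_def using diff(2) by (rule LeastI[of "\<lambda>i. d i \<noteq> d' i"])
    show "d i = d' i" if "i < k" for i
      using not_less_Least[of i "\<lambda>i. d i \<noteq> d' i"] that unfolding k_def by blast
    show "k \<le> i"
      unfolding k_def using diff(2) by (rule Least_le[of "\<lambda>i. d i \<noteq> d' i"])
  qed
  have "k < N" using k(3) diff(1) by simp
  have se: "summable e" unfolding e_def by (rule sm) (rule d1)
  have "(\<Sum>i. e i) = (\<Sum>i. e (i + Suc k)) + (\<Sum>i<Suc k. e i)"
    by (rule suminf_split_initial_segment[OF se])
  also have "(\<Sum>i<Suc k. e i) = e k"
    using k(2) by (simp add: e_def)
  finally have split: "(\<Sum>i. e i) = (\<Sum>i. e (i + Suc k)) + e k" .
  have ek: "\<bar>e k\<bar> = (1/3)^k"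
    using k(1) d[of k] d'[of k] by (auto simp: e_def abs_mult)
  have g: "(\<lambda>i. (1/3)^Suc k * (1/3::real)^i) sums ((1/3)^Suc k * (1 / (1 - 1/3)))"
    by (intro sums_mult geometric_sums) auto
  have "norm (\<Sum>i. e (i + Suc k)) \<le> (\<Sum>i. (1/3)^Suc k * (1/3::real)^i)"
  proof (rule norm_suminf_le)
    show "norm (e (i + Suc k)) \<le> (1/3)^Suc k * (1/3::real)^i" for i
      using d1(3)[of "i + Suc k"] by (simp add: e_def abs_mult power_add divide_simps)
    show "summable (\<lambda>i. (1/3)^Suc k * (1/3::real)^i)" using g by (rule sums_summable)
  qed
  also have "\<dots> = (1/3)^k / 2"
    using sums_unique[OF g] by simp
  finally have "\<bar>\<Sum>i. e i\<bar> \<ge> (1/3)^k / 2"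
    unfolding split using ek unfolding real_norm_def by arith
  moreover have "(1/3::real)^N \<le> (1/3)^k"
    using \<open>k < N\<close> by (intro power_decreasing) auto
  ultimately show ?thesis unfolding eq by linarith
qed

text \<open>
  A compact metric space has few tools attached to it, whereas Borel measures on the real line come
  with Helly's selection theorem and inner regularity by compact sets. This coding transfers both.
  The point \<open>x\<close> is sent to the real number whose ternary digits say which members of a fine countable
  open cover contain it. Two points with close codes share many digits, hence a small member of the
  cover, so the inverse of the coding is uniformly continuous; by compactness it extends continuously
  to the closure \<open>C\<close> of the range, and this extension is \<open>p\<close>.
\<close>

lemma compact_metric_real_code:
  assumes cpt: "compact (UNIV :: 'a::metric_space set)"
  obtains s :: "'a::metric_space \<Rightarrow> real" and C :: "real set" and p :: "real \<Rightarrow> 'a::metric_space"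
  where "s \<in> borel_measurable borel" "compact C" "range s \<subseteq> C"
    "continuous_on C p" "p \<in> borel_measurable borel" "\<And>x. p (s x) = x"
proof -
  obtain U :: "nat \<Rightarrow> 'a set" where U: "\<And>i. open (U i)"
      "\<And>e. e > 0 \<Longrightarrow> \<exists>N. \<forall>x. \<exists>i<N. x \<in> U i \<and> (\<forall>y\<in>U i. \<forall>z\<in>U i. dist y z < e)"
    using compact_fine_countable_cover[OF cpt] by blast
  define s where "s x = (\<Sum>i. (1/3)^i * indicator (U i) x :: real)" for x
  have meas: "s \<in> borel_measurable borel"
    unfolding s_def using U(1) by (intro borel_measurable_suminf borel_measurable_times
        borel_measurable_indicator) auto
  \<comment> \<open>Any two points with close codes lie in a common cover element of small diameter.\<close>
  have unif: "\<exists>d>0. \<forall>x y. \<bar>s x - s y\<bar> < d \<longrightarrow> dist x y < e" if e: "e > 0" for e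
  proof -
    obtain N where N: "\<forall>x. \<exists>i<N. x \<in> U i \<and> (\<forall>y\<in>U i. \<forall>z\<in>U i. dist y z < e)"
      using U(2)[OF e] by blast
    show ?thesis
    proof (intro exI[of _ "(1/3)^N/2"] conjI allI impI)
      fix x y assume close: "\<bar>s x - s y\<bar> < (1/3)^N/2"
      obtain i where i: "i < N" "x \<in> U i" "\<And>z w. z \<in> U i \<Longrightarrow> w \<in> U i \<Longrightarrow> dist z w < e"
        using N by blast
      have "y \<in> U i"
      proof (rule ccontr)
        assume "y \<notin> U i"
        then have "\<bar>s x - s y\<bar> \<ge> (1/3)^N/2"
          unfolding s_def using i
          by (intro ternary_code_separates[of "\<lambda>i. indicator (U i) x" "\<lambda>i. indicator (U i) y" i])
            (auto simp: indicator_def)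
        with close show False by simp
      qed
      with i show "dist x y < e" by blast
    qed auto
  qed
  define C where "C = closure (range s)"
  have bnd: "s x \<in> {0..3/2}" for x
  proof -
    have sg: "(\<lambda>i. (1/3::real)^i) sums (3/2)"
      using geometric_sums[of "1/3::real"] by simp
    have le: "(1/3)^i * indicator (U i) x \<le> (1/3::real)^i" for i
      by (simp add: indicator_def)
    have sm: "summable (\<lambda>i. (1/3)^i * indicator (U i) x :: real)"
      by (rule summable_comparison_test'[OF sums_summable[OF sg]]) (auto simp: indicator_def)
    have "0 \<le> s x" unfolding s_def by (rule suminf_nonneg[OF sm]) auto
    moreover have "s x \<le> 3/2"
      unfolding s_def using suminf_le[OF le sm sums_summable[OF sg]] sums_unique[OF sg] by simp
    ultimately show ?thesis by simp
  qed
  have cC: "compact C"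
    unfolding C_def using bnd
    by (intro compact_closure[THEN iffD2] bounded_subset[OF bounded_closed_interval[of 0 "3/2"]]) auto
  \<comment> \<open>The points whose codes are near \<open>c\<close> cluster at a single point, the decoding of \<open>c\<close>.\<close>
  have "\<exists>x. \<forall>e>0. \<exists>d>0. \<forall>y. \<bar>s y - c\<bar> < d \<longrightarrow> dist y x < e" if "c \<in> C" for c
  proof -
    have "\<exists>u. (\<forall>n. u n \<in> range s) \<and> u \<longlonglongrightarrow> c"
      using that unfolding C_def closure_sequential .
    then obtain u where u: "\<And>n. u n \<in> range s" "u \<longlonglongrightarrow> c" by metis
    have "\<forall>n. \<exists>y. u n = s y" using u(1) by blast
    then obtain x where x: "\<And>n. u n = s (x n)" by metis
    have "\<exists>l\<in>UNIV. \<exists>r. strict_mono r \<and> (x \<circ> r) \<longlonglongrightarrow> l"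
      using cpt unfolding compact_def by simp
    then obtain l r where r: "strict_mono r" "(x \<circ> r) \<longlonglongrightarrow> l" by metis
    have "(u \<circ> r) \<longlonglongrightarrow> c" using LIMSEQ_subseq_LIMSEQ[OF u(2) r(1)] .
    show ?thesis
    proof (intro exI[of _ l] allI impI)
      fix e :: real assume e: "e > 0"
      obtain d where d: "d > 0" "\<And>x y. \<bar>s x - s y\<bar> < d \<Longrightarrow> dist x y < e/2"
        using unif[of "e/2"] e by auto
      show "\<exists>d>0. \<forall>y. \<bar>s y - c\<bar> < d \<longrightarrow> dist y l < e"
      proof (intro exI[of _ "d/2"] conjI allI impI)
        fix y assume y: "\<bar>s y - c\<bar> < d/2"
        have "eventually (\<lambda>n. dist ((u \<circ> r) n) c < d/2) sequentially"
          by (rule tendstoD[OF \<open>(u \<circ> r) \<longlonglongrightarrow> c\<close>]) (use d(1) in simp)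
        moreover have "eventually (\<lambda>n. dist ((x \<circ> r) n) l < e/2) sequentially"
          by (rule tendstoD[OF r(2)]) (use e in simp)
        ultimately have "eventually (\<lambda>n. dist y l < e) sequentially"
        proof eventually_elim
          case (elim n)
          have "\<bar>s y - s (x (r n))\<bar> < d"
            using elim(1) y unfolding o_def x dist_real_def by arith
          then have "dist y (x (r n)) < e/2" by (rule d(2))
          with elim(2) show ?case
            using dist_triangle[of y l "x (r n)"] by simp
        qed
        then show "dist y l < e" by simp
      qed (use d in auto)
    qed
  qed
  then obtain q where q: "\<And>c e. c \<in> C \<Longrightarrow> e > 0 \<Longrightarrow> \<exists>d>0. \<forall>y. \<bar>s y - c\<bar> < d \<longrightarrow> dist y (q c) < e"
    by metis
  have sC: "range s \<subseteq> C" unfolding C_def by (rule closure_subset)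
  define p where "p c = (if c \<in> C then q c else undefined)" for c
  have qs: "q (s x) = x" for x
  proof (rule ccontr)
    assume "q (s x) \<noteq> x"
    then obtain d where "d > 0" "\<forall>y. \<bar>s y - s x\<bar> < d \<longrightarrow> dist y (q (s x)) < dist x (q (s x))"
      using q[of "s x" "dist x (q (s x))"] sC by auto
    then have "dist x (q (s x)) < dist x (q (s x))" by (metis abs_zero diff_self)
    then show False by simp
  qed
  have cq: "continuous_on C q"
    unfolding continuous_on_iff
  proof (intro ballI allI impI)
    fix c and e :: real assume c: "c \<in> C" and e: "e > 0"
    obtain d where d: "d > 0" "\<And>y. \<bar>s y - c\<bar> < d \<Longrightarrow> dist y (q c) < e/2"
      using q[OF c, of "e/2"] e by auto
    show "\<exists>d>0. \<forall>c'\<in>C. dist c' c < d \<longrightarrow> dist (q c') (q c) < e"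
    proof (intro exI[of _ "d/2"] conjI ballI impI)
      fix c' assume c': "c' \<in> C" "dist c' c < d/2"
      obtain d' where d': "d' > 0" "\<And>y. \<bar>s y - c'\<bar> < d' \<Longrightarrow> dist y (q c') < e/2"
        using q[OF c'(1), of "e/2"] e by auto
      have "min d' (d/2) > 0" using d(1) d'(1) by auto
      then obtain y where y: "dist (s y) c' < min d' (d/2)"
        using c'(1) unfolding C_def closure_approachable by blast
      have "dist y (q c') < e/2" using y by (intro d') (simp add: dist_real_def)
      moreover have "dist y (q c) < e/2"
        using dist_triangle[of "s y" c c'] y c'(2) by (intro d) (simp add: dist_real_def)
      ultimately show "dist (q c') (q c) < e"
        using dist_triangle3[of "q c'" "q c" y] by simp
    qed (use d in auto)
  qed
  show thesis
  proof (rule that[of s C p])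
    show "continuous_on C p"
      using cq by (rule continuous_on_eq) (simp add: p_def)
    have "C \<in> sets borel" using cC by (intro borel_closed compact_imp_closed)
    then have "(\<lambda>c. if c \<in> C then q c else undefined) \<in> borel_measurable borel"
      using cq by (intro borel_measurable_continuous_on_if) auto
    then show "p \<in> borel_measurable borel" unfolding p_def[abs_def] .
    show "p (s x) = x" for x using sC qs by (auto simp: p_def)
  qed (use meas cC sC in auto)
qed

section \<open>Weak-* compactness and inner regularity\<close>

text \<open>
  The indicator of a closed set is a decreasing limit of continuous functions of the distance to the
  set, and the closed sets form an intersection-stable generator of the Borel sets.
\<close>

lemma measure_eqI_continuous_integral:
  fixes M N :: "'a::metric_space measure"
  assumes "prob_space M" "prob_space N" and sM: "sets M = sets borel" and sN: "sets N = sets borel"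
    and eq: "\<And>g :: 'a \<Rightarrow> real. continuous_on UNIV g \<Longrightarrow> (\<And>x. \<bar>g x\<bar> \<le> 1) \<Longrightarrow> integral\<^sup>L M g = integral\<^sup>L N g"
  shows "M = N"
proof -
  interpret M: prob_space M by fact
  interpret N: prob_space N by fact
  have closed_eq: "measure M F = measure N F" if F: "closed F" "F \<noteq> {}" for F
  proof -
    define g where "g n x = max 0 (1 - real n * infdist x F)" for n x
    have cg: "continuous_on UNIV (g n)" for n
      unfolding g_def by (intro continuous_intros)
    have bg: "\<bar>g n x\<bar> \<le> 1" for n x
      unfolding g_def by (simp add: infdist_nonneg)
    have lim: "(\<lambda>n. g n x) \<longlonglongrightarrow> indicator F x" for x
    proof (cases "x \<in> F")
      case True
      then show ?thesis by (simp add: g_def)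
    next
      case False
      then have pos: "infdist x F > 0"
        using F in_closed_iff_infdist_zero[OF F] infdist_nonneg[of x F] by (metis less_eq_real_def)
      obtain n0 :: nat where n0: "real n0 * infdist x F > 1"
        using reals_Archimedean3[OF pos] by blast
      have "eventually (\<lambda>n. g n x = 0) sequentially"
        using eventually_ge_at_top[of n0]
      proof eventually_elim
        case (elim n)
        then have "real n0 * infdist x F \<le> real n * infdist x F"
          using pos by (intro mult_right_mono) auto
        with n0 show ?case by (simp add: g_def)
      qed
      with False show ?thesis by (simp add: tendsto_eventually)
    qed
    have conv: "(\<lambda>n. integral\<^sup>L K (g n)) \<longlonglongrightarrow> measure K F"
      if "prob_space K" "sets K = sets borel" for K
    proof -
      interpret K: prob_space K by fact
      have [measurable]: "F \<in> sets K" using F that by auto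
      have mg: "g n \<in> borel_measurable K" for n
        using borel_measurable_continuous_onI[OF cg] that(2) by (simp cong: measurable_cong_sets)
      have "(\<lambda>n. integral\<^sup>L K (g n)) \<longlonglongrightarrow> integral\<^sup>L K (indicator F)"
        by (rule integral_dominated_convergence[where w = "\<lambda>_. 1"])
          (use lim bg mg in \<open>auto intro!: borel_measurable_indicator\<close>)
      then show ?thesis using sets.sets_into_space[OF \<open>F \<in> sets K\<close>]
        by (simp add: Int_absorb2)
    qed
    have "(\<lambda>n. integral\<^sup>L M (g n)) = (\<lambda>n. integral\<^sup>L N (g n))"
      using eq[OF cg bg] by auto
    then show ?thesis
      using conv[OF M.prob_space_axioms sM] conv[OF N.prob_space_axioms sN] LIMSEQ_unique by metis
  qed
  have spM: "space M = UNIV" and spN: "space N = UNIV"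
    using sM sN by (auto dest: sets_eq_imp_space_eq)
  show ?thesis
  proof (rule measure_eqI_generator_eq[where E = "Collect closed" and \<Omega> = UNIV and A = "\<lambda>_. UNIV"])
    show "Int_stable (Collect (closed :: 'a set \<Rightarrow> bool))" by (auto simp: Int_stable_def)
    show "emeasure M F = emeasure N F" if "F \<in> Collect closed" for F
      using that closed_eq[of F] by (cases "F = {}") (auto simp: M.emeasure_eq_measure N.emeasure_eq_measure)
    show "sets M = sigma_sets UNIV (Collect closed)" "sets N = sigma_sets UNIV (Collect closed)"
      using sM sN by (simp_all add: borel_eq_closed)
  qed auto
qed

text \<open>
  Weak-* sequential compactness without a representation theorem for functionals. The codes of the
  given measures live on one compact subset \<open>C\<close> of the line and are therefore tight; Helly's theorem
  gives a limit law there, and decoding it gives the limit on the original space. A continuous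
  integrand becomes continuous on \<open>C\<close> after decoding, and extends to the line by Tietze's theorem.
\<close>

lemma prob_measures_seq_compact:
  fixes \<mu> :: "nat \<Rightarrow> 'a::metric_space measure"
  assumes cpt: "compact (UNIV :: 'a set)"
    and prob: "\<And>n. prob_space (\<mu> n)" and sets: "\<And>n. sets (\<mu> n) = sets borel"
  obtains r \<nu> where "strict_mono (r :: nat \<Rightarrow> nat)" "prob_space \<nu>" "sets \<nu> = sets borel"
    "\<And>g :: 'a \<Rightarrow> real. continuous_on UNIV g \<Longrightarrow> (\<lambda>n. integral\<^sup>L (\<mu> (r n)) g) \<longlonglongrightarrow> integral\<^sup>L \<nu> g"
proof -
  obtain s :: "'a \<Rightarrow> real" and C p where sm: "s \<in> borel_measurable borel" and C: "compact C" "range s \<subseteq> C"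
    and p: "continuous_on C p" "p \<in> borel_measurable borel" "\<And>x. p (s x) = x"
    using compact_metric_real_code[OF cpt] by blast
  have [measurable]: "s \<in> borel_measurable (\<mu> n)" for n
    using sm sets by (simp cong: measurable_cong_sets)
  define \<sigma> where "\<sigma> n = distr (\<mu> n) borel s" for n
  have rd: "real_distribution (\<sigma> n)" for n
    unfolding real_distribution_def real_distribution_axioms_def \<sigma>_def
    using prob_space.prob_space_distr[OF prob[of n], of s borel] by simp
  have "C \<noteq> {}" using C(2) by auto
  obtain b where b: "b > 0" "\<And>c. c \<in> C \<Longrightarrow> \<bar>c\<bar> < b"
    using compact_imp_bounded[OF C(1)] unfolding bounded_pos_less by (auto simp: real_norm_def)
  have "tight \<sigma>"
    unfolding tight_def
  proof (intro conjI allI impI rd)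
    fix \<epsilon> :: real assume "\<epsilon> > 0"
    show "\<exists>a b. a < b \<and> (\<forall>n. 1 - \<epsilon> < measure (\<sigma> n) {a<..b})"
    proof (rule exI[of _ "-b"], rule exI[of _ b], intro conjI allI)
      fix n
      have "-b < s x \<and> s x \<le> b" for x
        using b(2)[of "s x"] C(2) range_subsetD[OF C(2), of x] by (simp add: abs_less_iff)
      then have "s -` {-b<..b} \<inter> space (\<mu> n) = space (\<mu> n)" by auto
      then have "measure (\<sigma> n) {-b<..b} = 1"
        unfolding \<sigma>_def by (subst measure_distr) (auto simp: prob_space.prob_space[OF prob])
      then show "1 - \<epsilon> < measure (\<sigma> n) {-b<..b}" using \<open>\<epsilon> > 0\<close> by simp
    qed (use b in auto)
  qed
  from tight_imp_convergent_subsubsequence[OF this strict_mono_id]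
  obtain r m where r: "strict_mono r" and m: "real_distribution m" "weak_conv_m (\<sigma> \<circ> r) m"
    by auto
  interpret m: real_distribution m by fact
  have conv: "(\<lambda>n. integral\<^sup>L (\<mu> (r n)) (\<lambda>x. h (s x))) \<longlonglongrightarrow> integral\<^sup>L m h"
    if h: "continuous_on UNIV h" "\<And>x. norm (h x) \<le> B" for h :: "real \<Rightarrow> real" and B
  proof -
    have "(\<lambda>n. integral\<^sup>L ((\<sigma> \<circ> r) n) h) \<longlonglongrightarrow> integral\<^sup>L m h"
      by (rule weak_conv_imp_integral_bdd_continuous_conv[where B = B])
        (use rd m h in \<open>simp_all add: o_def continuous_on_eq_continuous_at\<close>)
    then show ?thesis
      unfolding \<sigma>_def o_def
      by (subst (asm) integral_distr) (auto intro: borel_measurable_continuous_onI h)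
  qed
  \<comment> \<open>The limit does not charge the complement of \<open>C\<close>: test against the truncated distance to \<open>C\<close>.\<close>
  have AEC: "AE x in m. x \<in> C"
  proof -
    define h where "h x = min 1 (infdist x C)" for x
    have ch: "continuous_on UNIV h" unfolding h_def by (intro continuous_intros)
    have bh: "norm (h x) \<le> 1" "h x \<ge> 0" for x by (auto simp: h_def infdist_nonneg)
    have "h (s x) = 0" for x using range_subsetD[OF C(2), of x] by (simp add: h_def)
    then have "(\<lambda>n::nat. 0) \<longlonglongrightarrow> integral\<^sup>L m h"
      using conv[OF ch bh(1)] by simp
    then have "integral\<^sup>L m h = 0" by (simp add: LIMSEQ_const_iff)
    moreover have "integrable m h"
      by (rule m.integrable_const_bound[where B = 1])
        (use bh borel_measurable_continuous_onI[OF ch] in auto)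
    ultimately have "AE x in m. h x = 0"
      using integral_nonneg_eq_0_iff_AE[of m h] bh(2) by simp
    then show ?thesis
    proof eventually_elim
      case (elim x)
      then have "infdist x C = 0" by (simp add: h_def min_def split: if_splits)
      then show ?case
        using in_closed_iff_infdist_zero[OF compact_imp_closed[OF C(1)] \<open>C \<noteq> {}\<close>] by simp
    qed
  qed
  define \<nu> where "\<nu> = distr m borel p"
  show thesis
  proof (rule that[OF r])
    have [measurable]: "p \<in> measurable m borel" using p(2) by (simp cong: measurable_cong_sets)
    show "prob_space \<nu>" unfolding \<nu>_def by (rule m.prob_space_distr) simp
    show "sets \<nu> = sets borel" by (simp add: \<nu>_def)
    fix g :: "'a \<Rightarrow> real" assume g: "continuous_on UNIV g"
    have mg: "g \<in> borel_measurable borel" using g by (rule borel_measurable_continuous_onI)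
    have "bounded (range g)" using compact_continuous_image[OF g cpt] by (rule compact_imp_bounded)
    then obtain B where B: "B > 0" "\<And>x. norm (g x) \<le> B" unfolding bounded_pos by auto
    have "continuous_on C (\<lambda>c. g (p c))"
      using continuous_on_compose2[OF g p(1)] by simp
    then obtain h where h: "continuous_on UNIV h" "\<And>c. c \<in> C \<Longrightarrow> h c = g (p c)" "\<And>x. norm (h x) \<le> B"
      by (rule Tietze[of C "\<lambda>c. g (p c)" UNIV B])
        (use B compact_imp_closed[OF C(1)] in \<open>auto simp: closed_closedin[symmetric]\<close>)
    have "integral\<^sup>L \<nu> g = integral\<^sup>L m (\<lambda>c. g (p c))"
      unfolding \<nu>_def by (rule integral_distr) (use mg in auto)
    also have "\<dots> = integral\<^sup>L m h"
      by (rule integral_cong_AE)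
        (use AEC h(2) mg borel_measurable_continuous_onI[OF h(1)] in \<open>auto elim!: eventually_mono\<close>)
    finally have "integral\<^sup>L \<nu> g = integral\<^sup>L m h" .
    moreover have "h (s x) = g x" for x using h(2)[of "s x"] C(2) p(3) by auto
    ultimately show "(\<lambda>n. integral\<^sup>L (\<mu> (r n)) g) \<longlonglongrightarrow> integral\<^sup>L \<nu> g"
      using conv[OF h(1,3)] by simp
  qed
qed

text \<open>
  Inner regularity of the image measure on the line is pulled back: the decoding map carries a
  compact set of codes to a compact set of points.
\<close>

lemma compact_inner_regular:
  fixes \<mu> :: "'a::metric_space measure"
  assumes cpt: "compact (UNIV :: 'a set)"
    and "prob_space \<mu>" and sets: "sets \<mu> = sets borel" and A: "A \<in> sets borel" and e: "e > 0"
  obtains K where "compact K" "K \<subseteq> A" "measure \<mu> (A - K) < e"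
proof -
  interpret prob_space \<mu> by fact
  obtain s :: "'a \<Rightarrow> real" and C p where sm: "s \<in> borel_measurable borel" and C: "compact C" "range s \<subseteq> C"
    and p: "continuous_on C p" "p \<in> borel_measurable borel" "\<And>x. p (s x) = x"
    using compact_metric_real_code[OF cpt] by blast
  have [measurable]: "s \<in> borel_measurable \<mu>"
    using sm sets by (simp cong: measurable_cong_sets)
  define m where "m = distr \<mu> borel s"
  interpret m: prob_space m unfolding m_def by (rule prob_space_distr) simp
  have [measurable_dest]: "sets m = sets borel" by (simp add: m_def)
  have sp: "space \<mu> = UNIV" using sets by (auto dest: sets_eq_imp_space_eq)
  define B where "B = p -` A \<inter> C"
  have B: "B \<in> sets borel"
    unfolding B_def using p(2) A compact_imp_closed[OF C(1)] measurable_sets[of p borel borel A] by auto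
  have "s -` B = A" unfolding B_def using C(2) p(3) by auto
  then have mB: "measure m B = measure \<mu> A"
    unfolding m_def using B by (subst measure_distr) (auto simp: sp)
  obtain K where K: "compact K" "K \<subseteq> B" "measure m K > measure m B - e"
  proof -
    have "emeasure m B = (SUP K \<in> {K. K \<subseteq> B \<and> compact K}. emeasure m K)"
      by (rule inner_regular) (use B m.emeasure_finite in \<open>auto simp: m_def\<close>)
    moreover have "ennreal (measure m B - e) < emeasure m B \<or> measure m B = 0"
      using e by (cases "measure m B = 0") (auto simp: m.emeasure_eq_measure ennreal_less_iff[of "_ - e"] ennreal_lessI zero_less_measure_iff)
    ultimately consider "measure m B = 0" | "ennreal (measure m B - e) < (SUP K \<in> {K. K \<subseteq> B \<and> compact K}. emeasure m K)"
      by auto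
    then show thesis
    proof cases
      case 1
      then show thesis using that[of "{}"] e by simp
    next
      case 2
      then obtain K where K: "K \<subseteq> B" "compact K" "ennreal (measure m B - e) < ennreal (measure m K)"
        unfolding less_SUP_iff by (auto simp: m.emeasure_eq_measure)
      then have "measure m B - e < measure m K"
        by (meson ennreal_leI leD leI)
      with K that show thesis by blast
    qed
  qed
  show thesis
  proof (rule that[of "p ` K"])
    show ck: "compact (p ` K)"
      using K B_def by (intro compact_continuous_image[OF continuous_on_subset[OF p(1)]]) auto
    show sub: "p ` K \<subseteq> A" using K(2) by (auto simp: B_def)
    have pK: "p ` K \<in> sets borel" using ck by (intro borel_closed compact_imp_closed)
    have "measure m K = measure \<mu> (s -` K)"
      unfolding m_def using compact_imp_closed[OF K(1)] by (subst measure_distr) (auto simp: sp)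
    also have "\<dots> \<le> measure \<mu> (p ` K)"
      using p(3) pK by (intro finite_measure_mono) (auto simp: sets image_iff, metis)
    finally have "measure \<mu> (p ` K) > measure \<mu> A - e" using K(3) mB by simp
    then show "measure \<mu> (A - p ` K) < e"
      using finite_measure_Diff[of A "p ` K"] sub pK A sets by simp
  qed
qed

text \<open>
  Invariance passes to the limit because \<open>g \<circ> f\<close> is a continuous test function whenever \<open>g\<close> is.
\<close>

lemma invariant_measures_seq_compact:
  fixes f :: "'a::metric_space \<Rightarrow> 'a"
  assumes cf: "continuous_on UNIV f" and cpt: "compact (UNIV :: 'a set)"
    and inv: "\<And>n. \<mu> n \<in> invariant_measures f"
  obtains r \<nu> where "strict_mono (r :: nat \<Rightarrow> nat)" "\<nu> \<in> invariant_measures f"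
    "\<And>g :: 'a \<Rightarrow> real. continuous_on UNIV g \<Longrightarrow> (\<lambda>n. integral\<^sup>L (\<mu> (r n)) g) \<longlonglongrightarrow> integral\<^sup>L \<nu> g"
proof -
  have mu: "prob_space (\<mu> n)" "sets (\<mu> n) = sets borel" "distr (\<mu> n) borel f = \<mu> n" for n
    using inv by (auto simp: invariant_measures_def)
  obtain r \<nu> where r: "strict_mono (r :: nat \<Rightarrow> nat)" and nu: "prob_space \<nu>" "sets \<nu> = sets borel"
    and conv: "\<And>g :: 'a \<Rightarrow> real. continuous_on UNIV g \<Longrightarrow> (\<lambda>n. integral\<^sup>L (\<mu> (r n)) g) \<longlonglongrightarrow> integral\<^sup>L \<nu> g"
    by (rule prob_measures_seq_compact[OF cpt, of \<mu>]) (use mu in auto)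
  have mf: "f \<in> measurable borel borel" using cf by (rule borel_measurable_continuous_onI)
  have mf': "f \<in> measurable K borel" if "sets K = sets borel" for K
    using mf that by (simp cong: measurable_cong_sets)
  have "distr \<nu> borel f = \<nu>"
  proof (rule measure_eqI_continuous_integral)
    show "prob_space (distr \<nu> borel f)"
      by (rule prob_space.prob_space_distr[OF nu(1) mf'[OF nu(2)]])
    fix g :: "'a \<Rightarrow> real" assume g: "continuous_on UNIV g"
    have cgf: "continuous_on UNIV (\<lambda>x. g (f x))"
      using continuous_on_compose2[OF g cf] by simp
    have gf: "integral\<^sup>L (distr K borel f) g = integral\<^sup>L K (\<lambda>x. g (f x))" if "sets K = sets borel" for K
      by (rule integral_distr[OF mf'[OF that] borel_measurable_continuous_onI[OF g]])
    have "integral\<^sup>L (\<mu> n) (\<lambda>x. g (f x)) = integral\<^sup>L (\<mu> n) g" for n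
      using gf[OF mu(2)[of n]] mu(3)[of n] by simp
    then have "(\<lambda>n. integral\<^sup>L (\<mu> (r n)) g) \<longlonglongrightarrow> integral\<^sup>L \<nu> (\<lambda>x. g (f x))"
      using conv[OF cgf] by simp
    then show "integral\<^sup>L (distr \<nu> borel f) g = integral\<^sup>L \<nu> g"
      using conv[OF g] LIMSEQ_unique gf[OF nu(2)] by metis
  qed (use nu in auto)
  with r nu conv that show thesis by (auto simp: invariant_measures_def)
qed

text \<open>
  Convergence of all integrals of continuous functions is convergence in the weak-* topology, so a
  sequence converging in this sense eventually enters every open sublevel set.
\<close>

lemma usc_eventually_less:
  fixes f :: "'a::metric_space \<Rightarrow> 'a"
  assumes usc: "upper_semicontinuous_map (weak_star_topology f) h"
    and inv: "\<And>n. \<mu> n \<in> invariant_measures f" and nu: "\<nu> \<in> invariant_measures f"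
    and conv: "\<And>g :: 'a \<Rightarrow> real. continuous_on UNIV g \<Longrightarrow> (\<lambda>n. integral\<^sup>L (\<mu> n) g) \<longlonglongrightarrow> integral\<^sup>L \<nu> g"
    and less: "h \<nu> < c"
  shows "eventually (\<lambda>n. h (\<mu> n) < c) sequentially"
proof -
  have ev: "eventually (\<lambda>n. \<mu> n \<in> V) sequentially" 
    if "openin (weak_star_topology f) V" "\<nu> \<in> V" for V
  proof -
    have "generate_topology_on {{\<mu> \<in> invariant_measures f. integral\<^sup>L \<mu> g \<in> U} | (g :: 'a \<Rightarrow> real) U.
        continuous_on UNIV g \<and> open U} V"
      using that(1) unfolding weak_star_topology_def by (rule openin_topology_generated_by)
    then show ?thesis using that(2)
    proof induction
      case (Int a b)
      then show ?case by (auto intro: eventually_conj)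
    next
      case (UN K)
      then obtain k where k: "k \<in> K" "\<nu> \<in> k" by blast
      from UN.IH[OF this] show ?case using k(1) by (auto elim!: eventually_mono)
    next
      case (Basis V)
      then obtain g :: "'a \<Rightarrow> real" and U where gU: "V = {\<mu> \<in> invariant_measures f. integral\<^sup>L \<mu> g \<in> U}"
        "continuous_on UNIV g" "open U" by blast
      then have "eventually (\<lambda>n. integral\<^sup>L (\<mu> n) g \<in> U) sequentially"
        using topological_tendstoD[OF conv[OF gU(2)] gU(3)] Basis by auto
      then show ?case using inv gU(1) by (auto elim!: eventually_mono)
    qed simp
  qed
  \<comment> \<open>The zero integrand shows that the topology lives on all invariant measures.\<close>
  have "topspace (weak_star_topology f) = invariant_measures f"
  proof -
    have "{\<mu> \<in> invariant_measures f. integral\<^sup>L \<mu> (\<lambda>_::'a. 0::real) \<in> UNIV} \<subseteq> topspace (weak_star_topology f)"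
      unfolding weak_star_topology_def topology_generated_by_topspace
      by (rule Union_upper) (use continuous_on_const open_UNIV in blast)
    then show ?thesis
      unfolding weak_star_topology_def topology_generated_by_topspace by auto
  qed
  then have "eventually (\<lambda>n. \<mu> n \<in> {x \<in> invariant_measures f. h x < c}) sequentially"
    using ev[of "{x \<in> invariant_measures f. h x < c}"] usc nu less
    unfolding upper_semicontinuous_map_def by simp
  then show ?thesis by (auto elim!: eventually_mono)
qed

section \<open>Separated sets and joins of partitions\<close>

lemma continuous_on_funpow:
  fixes f :: "'a::topological_space \<Rightarrow> 'a"
  assumes "continuous_on UNIV f"
  shows "continuous_on UNIV (f ^^ n)"
proof (induction n)
  case (Suc n)
  then show ?case using continuous_on_compose2[OF assms Suc] by (simp add: o_def)
qed (simp add: id_def)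

lemma integral_birkhoff_sum:
  fixes f :: "'a::metric_space \<Rightarrow> 'a" and g :: "'a \<Rightarrow> real"
  assumes cf: "continuous_on UNIV f" and inv: "\<mu> \<in> invariant_measures f"
    and g: "g \<in> borel_measurable borel" and bd: "\<And>x. \<bar>g x\<bar> \<le> B"
  shows "integral\<^sup>L \<mu> (birkhoff_sum f g n) = real n * integral\<^sup>L \<mu> g"
    and "integrable \<mu> (birkhoff_sum f g n)"
proof -
  interpret prob_space \<mu> using inv by (simp add: invariant_measures_def)
  have sets: "sets \<mu> = sets borel" and di: "distr \<mu> borel f = \<mu>"
    using inv by (auto simp: invariant_measures_def)
  have mi: "f ^^ i \<in> measurable \<mu> borel" for i
    using borel_measurable_continuous_onI[OF continuous_on_funpow[OF cf]] sets
    by (simp cong: measurable_cong_sets)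
  have mf: "f \<in> measurable \<mu> borel" using mi[of 1] by simp
  have mg: "(\<lambda>x. g ((f ^^ i) x)) \<in> borel_measurable \<mu>" for i
    using measurable_compose[OF mi g] .
  have int: "integrable \<mu> (\<lambda>x. g ((f ^^ i) x))" for i
    by (rule integrable_const_bound[where B = B]) (use bd mg in auto)
  have eq: "integral\<^sup>L \<mu> (\<lambda>x. g ((f ^^ i) x)) = integral\<^sup>L \<mu> g" for i
  proof (induction i)
    case (Suc i)
    have mi': "(\<lambda>x. g ((f ^^ i) x)) \<in> borel_measurable borel"
      using mg[of i] sets by (simp cong: measurable_cong_sets)
    have "integral\<^sup>L \<mu> (\<lambda>x. g ((f ^^ i) (f x))) = integral\<^sup>L (distr \<mu> borel f) (\<lambda>x. g ((f ^^ i) x))"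
      by (rule integral_distr[OF mf mi', symmetric])
    then show ?case using Suc di by (simp add: funpow_swap1)
  qed simp
  show "integrable \<mu> (birkhoff_sum f g n)"
    unfolding birkhoff_sum_def[abs_def] using int by (intro Bochner_Integration.integrable_sum) auto
  show "integral\<^sup>L \<mu> (birkhoff_sum f g n) = real n * integral\<^sup>L \<mu> g"
    unfolding birkhoff_sum_def[abs_def]
    by (subst Bochner_Integration.integral_sum) (use int eq in auto)
qed

text \<open>
  Finitely many balls of radius \<open>\<delta> / 2\<close> for the metric that records the first \<open>n\<close> iterates cover the
  space, and each of them contains at most one point of a separated set.
\<close>

lemma separated_sets_card_bounded:
  fixes f :: "'a::metric_space \<Rightarrow> 'a"
  assumes cpt: "compact (UNIV :: 'a set)" and cf: "continuous_on UNIV f" and \<delta>: "\<delta> > 0"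
  obtains N where "\<And>E. E \<in> separated_sets f n \<delta> \<Longrightarrow> card E \<le> N"
proof -
  define V where "V x = (\<Inter>i<n. {z. dist ((f ^^ i) x) ((f ^^ i) z) < \<delta> / 2})" for x
  have op: "open (V x)" for x
    unfolding V_def
    by (intro open_INT ballI finite_lessThan open_Collect_less continuous_intros
        continuous_on_funpow cf)
  have "x \<in> V x" for x using \<delta> by (simp add: V_def)
  then have "UNIV \<subseteq> (\<Union>x\<in>UNIV. V x)" by auto
  from compactE_image[OF cpt op this]
  obtain D where D: "finite D" "UNIV \<subseteq> (\<Union>x\<in>D. V x)" by metis
  then have "\<forall>x. \<exists>d\<in>D. x \<in> V d" by blast
  then obtain d where d: "\<And>x. d x \<in> D" "\<And>x. x \<in> V (d x)" by metis
  show thesis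
  proof (rule that)
    fix E assume E: "E \<in> separated_sets f n \<delta>"
    have "inj_on d E"
    proof (rule inj_onI, rule ccontr)
      fix x y assume xy: "x \<in> E" "y \<in> E" "d x = d y" "x \<noteq> y"
      then obtain i where i: "i < n" "dist ((f ^^ i) x) ((f ^^ i) y) > \<delta>"
        using E by (auto simp: separated_sets_def)
      moreover have "dist ((f ^^ i) (d x)) ((f ^^ i) x) < \<delta> / 2" "dist ((f ^^ i) (d x)) ((f ^^ i) y) < \<delta> / 2"
        using d(2)[of x] d(2)[of y] xy(3) i(1) by (auto simp: V_def)
      ultimately show False
        using dist_triangle3[of "(f ^^ i) x" "(f ^^ i) y" "(f ^^ i) (d x)"] by simp
    qed
    then show "card E \<le> card D"
      using d(1) D(1) by (intro card_inj_on_le) auto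
  qed
qed

text \<open>
  A separated set of greatest cardinality is also spanning, since a point far from all its members
  could be added to it.
\<close>

lemma maximal_separated_set:
  fixes f :: "'a::metric_space \<Rightarrow> 'a"
  assumes cpt: "compact (UNIV :: 'a set)" and cf: "continuous_on UNIV f" and \<delta>: "\<delta> > 0"
  obtains E where "E \<in> separated_sets f n \<delta>"
    "\<And>x. \<exists>y\<in>E. \<forall>i<n. dist ((f ^^ i) x) ((f ^^ i) y) \<le> \<delta>"
proof -
  obtain N where N: "\<And>E. E \<in> separated_sets f n \<delta> \<Longrightarrow> card E \<le> N"
    using separated_sets_card_bounded[OF cpt cf \<delta>] by blast
  have "{} \<in> separated_sets f n \<delta>" by (simp add: separated_sets_def)
  moreover have "\<forall>E. E \<in> separated_sets f n \<delta> \<longrightarrow> card E < Suc N" using N by (simp add: less_Suc_eq_le)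
  ultimately have "\<exists>E. E \<in> separated_sets f n \<delta> \<and> (\<forall>E'. E' \<in> separated_sets f n \<delta> \<longrightarrow> card E' \<le> card E)"
    by (rule ex_has_greatest_nat)
  then obtain E where E: "E \<in> separated_sets f n \<delta>"
      "\<And>E'. E' \<in> separated_sets f n \<delta> \<Longrightarrow> card E' \<le> card E"
    by blast
  show thesis
  proof (rule that[OF E(1)], rule ccontr)
    fix x assume "\<not> (\<exists>y\<in>E. \<forall>i<n. dist ((f ^^ i) x) ((f ^^ i) y) \<le> \<delta>)"
    then have x: "\<forall>y\<in>E. \<exists>i<n. dist ((f ^^ i) x) ((f ^^ i) y) > \<delta>"
      by (auto simp: not_le)
    then have "x \<notin> E" using \<delta> by force
    have "insert x E \<in> separated_sets f n \<delta>"
      using E(1) x by (auto simp: separated_sets_def) (metis dist_commute)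
    from E(2)[OF this] show False
      using \<open>x \<notin> E\<close> E(1) by (simp add: separated_sets_def)
  qed
qed

text \<open>
  The real supremum in the definition of the pressure dominates each of its members only because
  the sums are bounded above.
\<close>

lemma separated_sum_le_SUP:
  fixes f :: "'a::metric_space \<Rightarrow> 'a" and \<psi> :: "'a \<Rightarrow> real"
  assumes cpt: "compact (UNIV :: 'a set)" and cf: "continuous_on UNIV f" and \<delta>: "\<delta> > 0"
    and bd: "\<And>x. \<bar>\<psi> x\<bar> \<le> B" and E: "E \<in> separated_sets f n \<delta>"
  shows "(\<Sum>x\<in>E. exp (birkhoff_sum f \<psi> n x))
    \<le> (SUP E\<in>separated_sets f n \<delta>. \<Sum>x\<in>E. exp (birkhoff_sum f \<psi> n x))"
proof (rule cSUP_upper[OF E])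
  obtain N where N: "\<And>E. E \<in> separated_sets f n \<delta> \<Longrightarrow> card E \<le> N"
    using separated_sets_card_bounded[OF cpt cf \<delta>] by blast
  show "bdd_above ((\<lambda>E. \<Sum>x\<in>E. exp (birkhoff_sum f \<psi> n x)) ` separated_sets f n \<delta>)"
  proof (rule bdd_aboveI2)
    fix E assume E: "E \<in> separated_sets f n \<delta>"
    have "birkhoff_sum f \<psi> n x \<le> real n * B" for x
      unfolding birkhoff_sum_def using sum_bounded_above[of "{..<n}" "\<lambda>i. \<psi> ((f ^^ i) x)" B] bd
      by (auto simp: abs_le_iff)
    then have "(\<Sum>x\<in>E. exp (birkhoff_sum f \<psi> n x)) \<le> real (card E) * exp (real n * B)"
      by (intro sum_bounded_above) simp
    also have "\<dots> \<le> real N * exp (real n * B)"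
      using N[OF E] by (intro mult_right_mono) auto
    finally show "(\<Sum>x\<in>E. exp (birkhoff_sum f \<psi> n x)) \<le> real N * exp (real n * B)" .
  qed
qed

lemma iterated_join_word:
  assumes "C \<in> iterated_join f \<xi> n"
  obtains A where "A \<in> {..<n} \<rightarrow>\<^sub>E \<xi>" "C = (\<Inter>i<n. (f ^^ i) -` A i)"
proof -
  obtain A where A: "\<forall>i<n. A i \<in> \<xi>" "C = (\<Inter>i<n. (f ^^ i) -` A i)"
    using assms by (auto simp: iterated_join_def)
  show thesis
    by (rule that[of "restrict A {..<n}"]) (use A in \<open>auto simp: PiE_def\<close>)
qed

lemma iterated_join_partition:
  fixes f :: "'a::metric_space \<Rightarrow> 'a"
  assumes cf: "continuous_on UNIV f" and \<xi>: "borel_partition \<xi>"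
  shows "borel_partition (iterated_join f \<xi> n)"
proof -
  have \<xi>': "finite \<xi>" "\<xi> \<subseteq> sets borel" "\<Union>\<xi> = UNIV" "disjoint \<xi>"
    using \<xi> by (auto simp: borel_partition_def partition_on_def)
  have mi: "f ^^ i \<in> borel_measurable borel" for i
    by (rule borel_measurable_continuous_onI[OF continuous_on_funpow[OF cf]])
  have "iterated_join f \<xi> n \<subseteq> (\<lambda>A. \<Inter>i<n. (f ^^ i) -` A i) ` ({..<n} \<rightarrow>\<^sub>E \<xi>)"
    by (auto elim: iterated_join_word)
  then have "finite (iterated_join f \<xi> n)"
    by (rule finite_subset) (use \<xi>' in \<open>auto intro!: finite_PiE\<close>)
  moreover have "C \<in> sets borel" if C: "C \<in> iterated_join f \<xi> n" for C
  proof -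
    obtain A where A: "A \<in> {..<n} \<rightarrow>\<^sub>E \<xi>" "C = (\<Inter>i<n. (f ^^ i) -` A i)"
      using C by (rule iterated_join_word)
    have "(f ^^ i) -` A i \<in> sets borel" if "i < n" for i
    proof -
      have "A i \<in> sets borel" using A(1) \<xi>'(2) that by auto
      from measurable_sets[OF mi this] show ?thesis by simp
    qed
    then show ?thesis
      unfolding A(2) by (cases "n = 0") (auto intro!: sets.finite_INT)
  qed
  moreover have "partition_on UNIV (iterated_join f \<xi> n)"
  proof (rule partition_onI)
    have "x \<in> \<Union>(iterated_join f \<xi> n)" for x
    proof -
      have "\<forall>z. \<exists>A\<in>\<xi>. z \<in> A" using \<xi>'(3) by blast
      then obtain a where a: "\<And>z. a z \<in> \<xi>" "\<And>z. z \<in> a z" by metis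
      define C where "C = (\<Inter>i<n. (f ^^ i) -` a ((f ^^ i) x))"
      have "x \<in> C" using a(2) by (simp add: C_def)
      moreover have "\<exists>A. C = (\<Inter>i<n. (f ^^ i) -` A i) \<and> (\<forall>i<n. A i \<in> \<xi>)"
        by (rule exI[of _ "\<lambda>i. a ((f ^^ i) x)"]) (simp add: C_def a(1))
      ultimately have "C \<in> iterated_join f \<xi> n"
        unfolding iterated_join_def by blast
      with \<open>x \<in> C\<close> show ?thesis by blast
    qed
    then show "\<Union>(iterated_join f \<xi> n) = UNIV" by blast
    show "{} \<notin> iterated_join f \<xi> n"
      by (simp add: iterated_join_def)
    show "disjnt C C'" if CC': "C \<in> iterated_join f \<xi> n" "C' \<in> iterated_join f \<xi> n" "C \<noteq> C'" for C C'
    proof (rule ccontr)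
      assume "\<not> disjnt C C'"
      then obtain x where x: "x \<in> C" "x \<in> C'" by (auto simp: disjnt_def)
      obtain A where A: "A \<in> {..<n} \<rightarrow>\<^sub>E \<xi>" "C = (\<Inter>i<n. (f ^^ i) -` A i)"
        using CC'(1) by (rule iterated_join_word)
      obtain A' where A': "A' \<in> {..<n} \<rightarrow>\<^sub>E \<xi>" "C' = (\<Inter>i<n. (f ^^ i) -` A' i)"
        using CC'(2) by (rule iterated_join_word)
      have "A i = A' i" if "i < n" for i
        using \<xi>'(4) that A A' x unfolding disjoint_def by blast
      then have "C = C'" unfolding A(2) A'(2) by auto
      with CC'(3) show False by simp
    qed
  qed
  ultimately show ?thesis by (auto simp: borel_partition_def)
qed

section \<open>Entropy and the Gibbs inequality\<close>

lemma sum_measure_partition: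
  fixes g :: "'a::metric_space \<Rightarrow> real"
  assumes "prob_space \<mu>" and sets: "sets \<mu> = sets borel" and P: "borel_partition P"
    and g: "integrable \<mu> g"
  shows "(\<Sum>C\<in>P. integral\<^sup>L \<mu> (\<lambda>x. indicator C x * g x)) = integral\<^sup>L \<mu> g"
    and "(\<Sum>C\<in>P. measure \<mu> C) = 1"
proof -
  interpret prob_space \<mu> by fact
  have P': "finite P" "P \<subseteq> sets borel" "\<Union>P = UNIV" "disjoint P"
    using P by (auto simp: borel_partition_def partition_on_def)
  have one: "(\<Sum>C\<in>P. indicator C x) = (1::real)" for x
  proof -
    obtain C where C: "C \<in> P" "x \<in> C" using P'(3) by blast
    have "(\<Sum>D\<in>P. indicator D x) = (\<Sum>D\<in>P. if D = C then 1 else (0::real))"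
      using C P'(4) by (intro sum.cong) (auto simp: indicator_def disjoint_def)
    then show ?thesis using C(1) P'(1) by simp
  qed
  have *: "(\<Sum>C\<in>P. integral\<^sup>L \<mu> (\<lambda>x. indicator C x * g x)) = integral\<^sup>L \<mu> g"
    if "integrable \<mu> g" for g :: "'a \<Rightarrow> real"
  proof -
    have "integrable \<mu> (\<lambda>x. indicator C x * g x)" if "C \<in> P" for C
      using integrable_real_mult_indicator[of C \<mu> g] \<open>integrable \<mu> g\<close> that P'(2) sets
      by (auto simp: mult.commute)
    then have "(\<Sum>C\<in>P. integral\<^sup>L \<mu> (\<lambda>x. indicator C x * g x)) = integral\<^sup>L \<mu> (\<lambda>x. \<Sum>C\<in>P. indicator C x * g x)"
      by (intro Bochner_Integration.integral_sum[symmetric]) auto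
    then show ?thesis by (simp add: sum_distrib_right[symmetric] one)
  qed
  show "(\<Sum>C\<in>P. integral\<^sup>L \<mu> (\<lambda>x. indicator C x * g x)) = integral\<^sup>L \<mu> g" by (rule *[OF g])
  have "integral\<^sup>L \<mu> (\<lambda>x. indicator C x * 1) = measure \<mu> C" if "C \<in> P" for C
    using that P'(2) sets sets.sets_into_space[of C \<mu>] by (auto simp: Int_absorb2)
  then have "(\<Sum>C\<in>P. measure \<mu> C) = (\<Sum>C\<in>P. integral\<^sup>L \<mu> (\<lambda>x. indicator C x * 1))"
    by (intro sum.cong) auto
  also have "\<dots> = 1" by (subst *) (auto simp: prob_space)
  finally show "(\<Sum>C\<in>P. measure \<mu> C) = 1" .
qed

text \<open>
  This is \<open>ln z \<le> z - 1\<close> applied to the quotient of the Gibbs weight of \<open>C\<close> by its mass \<open>m C\<close>.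
\<close>

lemma gibbs_variational_inequality:
  fixes m a :: "'b \<Rightarrow> real"
  assumes fin: "finite D" and pos: "\<And>C. C \<in> D \<Longrightarrow> m C > 0" and one: "(\<Sum>C\<in>D. m C) = 1"
  shows "(\<Sum>C\<in>D. m C * (a C - ln (m C))) \<le> ln (\<Sum>C\<in>D. exp (a C))"
proof -
  define Z where "Z = (\<Sum>C\<in>D. exp (a C))"
  have "D \<noteq> {}" using one by auto
  then have Z: "Z > 0" unfolding Z_def using fin by (intro sum_pos) auto
  have "(\<Sum>C\<in>D. m C * (a C - ln (m C))) - ln Z = (\<Sum>C\<in>D. m C * (a C - ln (m C))) - (\<Sum>C\<in>D. m C) * ln Z"
    using one by simp
  also have "\<dots> = (\<Sum>C\<in>D. m C * (a C - ln (m C) - ln Z))"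
    by (simp add: sum_distrib_right right_diff_distrib sum_subtractf)
  also have "\<dots> \<le> (\<Sum>C\<in>D. exp (a C) / Z - m C)"
  proof (rule sum_mono)
    fix C assume C: "C \<in> D"
    have "a C - ln (m C) - ln Z = ln (exp (a C) / (m C * Z))"
      using pos[OF C] Z by (simp add: ln_div ln_mult)
    also have "\<dots> \<le> exp (a C) / (m C * Z) - 1"
      using pos[OF C] Z by (intro ln_le_minus_one) simp
    finally have "m C * (a C - ln (m C) - ln Z) \<le> m C * (exp (a C) / (m C * Z) - 1)"
      using pos[OF C] by (intro mult_left_mono) auto
    also have "\<dots> = exp (a C) / Z - m C"
      using pos[OF C] Z by (simp add: field_simps)
    finally show "m C * (a C - ln (m C) - ln Z) \<le> exp (a C) / Z - m C" .
  qed
  also have "\<dots> = 0"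
    using one Z by (simp add: sum_subtractf sum_divide_distrib[symmetric] Z_def)
  finally show ?thesis by (simp add: Z_def)
qed

text \<open>
  On a cell of positive mass some point has a value of \<open>G\<close> at least the mean of \<open>G\<close> over the cell.
  Replacing \<open>G\<close> on each cell by such a value reduces the claim to the finite Gibbs inequality.
\<close>

lemma entropy_plus_integral_le:
  fixes G :: "'a::metric_space \<Rightarrow> real"
  assumes "prob_space \<mu>" and sets: "sets \<mu> = sets borel" and P: "borel_partition P"
    and G: "integrable \<mu> G"
  obtains D x where "D \<subseteq> P" "D \<noteq> {}" "\<And>C. C \<in> D \<Longrightarrow> x C \<in> C"
    "partition_entropy \<mu> P + integral\<^sup>L \<mu> G \<le> ln (\<Sum>C\<in>D. exp (G (x C)))"
proof -
  interpret prob_space \<mu> by fact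
  have P': "finite P" "P \<subseteq> sets \<mu>" using P sets by (auto simp: borel_partition_def)
  define D where "D = {C \<in> P. measure \<mu> C > 0}"
  have DP: "D \<subseteq> P" "finite D" using P' by (auto simp: D_def)
  have null: "measure \<mu> C = 0" "C \<in> null_sets \<mu>" if "C \<in> P - D" for C
    using that P'(2) measure_nonneg[of \<mu> C] by (auto simp: D_def emeasure_eq_measure not_less)
  have int: "integrable \<mu> (\<lambda>x. indicator C x * G x)" if "C \<in> P" for C
    using integrable_real_mult_indicator[of C \<mu> G] G that P'(2) by (auto simp: mult.commute)
  \<comment> \<open>Otherwise \<open>G\<close> lies strictly below its mean on a set of positive mass.\<close>
  have "\<exists>x\<in>C. integral\<^sup>L \<mu> (\<lambda>x. indicator C x * G x) \<le> measure \<mu> C * G x" if C: "C \<in> D" for C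
  proof (rule ccontr)
    define I where "I = integral\<^sup>L \<mu> (\<lambda>x. indicator C x * G x)"
    define v where "v = I / measure \<mu> C"
    have pos: "measure \<mu> C > 0" and CP: "C \<in> P" and Cs: "C \<in> sets \<mu>" using C P' by (auto simp: D_def)
    assume "\<not> ?thesis"
    then have lt: "G x < v" if "x \<in> C" for x
      using that pos by (auto simp: v_def I_def field_simps not_le)
    have intv: "integrable \<mu> (\<lambda>x. indicator C x * v)"
      using integrable_real_mult_indicator[OF Cs integrable_const[of v]] by (simp add: mult.commute)
    have "integral\<^sup>L \<mu> (\<lambda>x. indicator C x * v - indicator C x * G x) = measure \<mu> C * v - I"
      unfolding I_def using int[OF CP] intv Cs sets.sets_into_space[OF Cs]
      by (subst Bochner_Integration.integral_diff) (auto simp: Int_absorb2)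
    also have "\<dots> = 0" using pos by (simp add: v_def)
    finally have "AE x in \<mu>. indicator C x * v - indicator C x * G x = 0"
      by (subst (asm) integral_nonneg_eq_0_iff_AE)
        (use int[OF CP] intv lt in \<open>auto simp: indicator_def less_imp_le\<close>)
    then have "AE x in \<mu>. x \<notin> C"
      by eventually_elim (use lt in \<open>auto simp: indicator_def\<close>)
    then have "measure \<mu> C = 0"
      using Cs AE_iff_null_sets[OF Cs] by (simp add: measure_eq_0_null_sets)
    with pos show False by simp
  qed
  then obtain x where x: "\<And>C. C \<in> D \<Longrightarrow> x C \<in> C"
      "\<And>C. C \<in> D \<Longrightarrow> integral\<^sup>L \<mu> (\<lambda>x. indicator C x * G x) \<le> measure \<mu> C * G (x C)"
    by metis
  show thesis
  proof (rule that[OF DP(1) _ x(1)])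
    have "integral\<^sup>L \<mu> G = (\<Sum>C\<in>P. integral\<^sup>L \<mu> (\<lambda>x. indicator C x * G x))"
      using sum_measure_partition(1)[OF assms] by simp
    also have "\<dots> = (\<Sum>C\<in>D. integral\<^sup>L \<mu> (\<lambda>x. indicator C x * G x))"
    proof (rule sum.mono_neutral_right[OF P'(1) DP(1)], rule ballI)
      fix C assume "C \<in> P - D"
      then have "AE x in \<mu>. x \<notin> C" using null(2) AE_not_in by blast
      then show "integral\<^sup>L \<mu> (\<lambda>x. indicator C x * G x) = 0"
        by (intro integral_eq_zero_AE) (auto elim!: eventually_mono simp: indicator_def)
    qed
    also have "\<dots> \<le> (\<Sum>C\<in>D. measure \<mu> C * G (x C))" by (intro sum_mono x(2))
    finally have 1: "integral\<^sup>L \<mu> G \<le> (\<Sum>C\<in>D. measure \<mu> C * G (x C))" .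
    have 2: "partition_entropy \<mu> P = - (\<Sum>C\<in>D. measure \<mu> C * ln (measure \<mu> C))"
      unfolding partition_entropy_def neg_equal_iff_equal
      by (rule sum.mono_neutral_right[OF P'(1) DP(1)]) (use null in auto)
    have 3: "(\<Sum>C\<in>D. measure \<mu> C) = 1"
    proof -
      have "(\<Sum>C\<in>D. measure \<mu> C) = (\<Sum>C\<in>P. measure \<mu> C)"
        by (rule sum.mono_neutral_left[OF P'(1) DP(1)]) (use null in auto)
      then show ?thesis using sum_measure_partition(2)[OF assms] by simp
    qed
    then show "D \<noteq> {}" by auto
    have "partition_entropy \<mu> P + integral\<^sup>L \<mu> G
        \<le> (\<Sum>C\<in>D. measure \<mu> C * (G (x C) - ln (measure \<mu> C)))"
      using 1 2 by (simp add: right_diff_distrib sum_subtractf)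
    also have "\<dots> \<le> ln (\<Sum>C\<in>D. exp (G (x C)))"
      by (rule gibbs_variational_inequality[OF DP(2) _ 3]) (auto simp: D_def)
    finally show "partition_entropy \<mu> P + integral\<^sup>L \<mu> G \<le> ln (\<Sum>C\<in>D. exp (G (x C)))" .
  qed
qed

section \<open>The variational inequality\<close>

lemma compact_closed_positive_distance:
  fixes S T :: "'a::metric_space set"
  assumes "compact S" "closed T" "S \<inter> T = {}"
  obtains d where "d > 0" "\<And>x y. x \<in> S \<Longrightarrow> y \<in> T \<Longrightarrow> d \<le> dist x y"
proof (cases "S = {} \<or> T = {}")
  case True
  then show thesis using that[of 1] by auto
next
  case False
  have "continuous_on S (\<lambda>x. infdist x T)" by (intro continuous_intros)
  from continuous_attains_inf[OF assms(1) _ this] False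
  obtain x where x: "x \<in> S" "\<And>y. y \<in> S \<Longrightarrow> infdist x T \<le> infdist y T" by blast
  show thesis
  proof (rule that)
    have "x \<notin> T" using assms(3) x(1) by blast
    then have "infdist x T \<noteq> 0" using in_closed_iff_infdist_zero[OF assms(2)] False by blast
    then show "infdist x T > 0" using infdist_nonneg[of x T] by simp
    show "infdist x T \<le> dist y z" if "y \<in> S" "z \<in> T" for y z
      using x(2)[OF that(1)] infdist_le[OF that(2), of y] by simp
  qed
qed

lemma finite_disjoint_compacts_positive_distance:
  fixes K :: "'b \<Rightarrow> 'a::metric_space set"
  assumes fin: "finite I" and K: "\<And>i. i \<in> I \<Longrightarrow> compact (K i)"
    and disj: "\<And>i j. i \<in> I \<Longrightarrow> j \<in> I \<Longrightarrow> i \<noteq> j \<Longrightarrow> K i \<inter> K j = {}"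
  obtains d where "d > 0"
    "\<And>i j x y. i \<in> I \<Longrightarrow> j \<in> I \<Longrightarrow> x \<in> K i \<Longrightarrow> y \<in> K j \<Longrightarrow> dist x y < d \<Longrightarrow> i = j"
proof -
  define J where "J = {(i, j) \<in> I \<times> I. i \<noteq> j}"
  have "\<exists>d>0. \<forall>x\<in>K (fst q). \<forall>y\<in>K (snd q). d \<le> dist x y" if "q \<in> J" for q
  proof -
    have "compact (K (fst q))" "closed (K (snd q))" "K (fst q) \<inter> K (snd q) = {}"
      using that K compact_imp_closed[OF K] disj[of "fst q" "snd q"] by (auto simp: J_def)
    from compact_closed_positive_distance[OF this] show ?thesis by metis
  qed
  then obtain d where d: "\<And>q. q \<in> J \<Longrightarrow> d q > (0::real)"
      "\<And>q x y. q \<in> J \<Longrightarrow> x \<in> K (fst q) \<Longrightarrow> y \<in> K (snd q) \<Longrightarrow> d q \<le> dist x y"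
    by metis
  have fJ: "finite J" by (rule finite_subset[of _ "I \<times> I"]) (use fin in \<open>auto simp: J_def\<close>)
  show thesis
  proof (rule that[of "Min (insert 1 (d ` J))"])
    show "Min (insert 1 (d ` J)) > 0" using fJ d(1) by simp
    fix i j x y
    assume ij: "i \<in> I" "j \<in> I" "x \<in> K i" "y \<in> K j" "dist x y < Min (insert 1 (d ` J))"
    show "i = j"
    proof (rule ccontr)
      assume "i \<noteq> j"
      then have q: "(i, j) \<in> J" using ij by (simp add: J_def)
      then have "Min (insert 1 (d ` J)) \<le> d (i, j)" using fJ by simp
      also have "\<dots> \<le> dist x y" using d(2)[OF q] ij by simp
      finally show False using ij(5) by simp
    qed
  qed
qed

text \<open>
  The counting step of the variational inequality. Every chosen point \<open>x C\<close> is shadowed by a point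
  \<open>y\<close> of the spanning set \<open>E\<close>, and the difficulty is that many cells may share the same \<open>y\<close>. At a time
  when the orbit of \<open>x C\<close> is in one of the separated sets \<open>B A\<close>, the atom \<open>A\<close> is determined by \<open>y\<close>; at
  every other time the orbit is in the small set \<open>U = (\<Union>A\<in>\<xi>. A - B A)\<close> and there are at most
  \<open>card \<xi>\<close> choices, but there the penalty \<open>c\<close> contributes a factor \<open>exp (- c)\<close>. Summed over all
  itineraries, one unit of time therefore costs at most the factor
  \<open>1 + card \<xi> * exp (- c) \<le> exp \<epsilon>\<close>; a second factor \<open>exp \<epsilon>\<close> accounts for moving \<open>\<psi>\<close> from the
  orbit of \<open>x C\<close> to that of \<open>y\<close>.
\<close>

lemma shadow_sum_le:
  fixes f :: "'a::metric_space \<Rightarrow> 'a" and \<psi> :: "'a \<Rightarrow> real"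
  assumes \<xi>: "borel_partition \<xi>"
    and B: "\<And>A. A \<in> \<xi> \<Longrightarrow> B A \<subseteq> A"
    and sep: "\<And>A A' x y. A \<in> \<xi> \<Longrightarrow> A' \<in> \<xi> \<Longrightarrow> x \<in> B A \<Longrightarrow> y \<in> B A' \<Longrightarrow> dist x y < d \<Longrightarrow> A = A'"
    and \<delta>: "2 * \<delta> < d"
    and unif: "\<And>x y. dist x y \<le> \<delta> \<Longrightarrow> \<bar>\<psi> x - \<psi> y\<bar> \<le> \<epsilon>"
    and c: "c \<ge> 0" "real (card \<xi>) * exp (- c) \<le> \<epsilon>"
    and D: "D \<subseteq> iterated_join f \<xi> n" "finite D" "\<And>C. C \<in> D \<Longrightarrow> x C \<in> C"
    and E: "finite E" "\<And>z. \<exists>y\<in>E. \<forall>i<n. dist ((f ^^ i) z) ((f ^^ i) y) \<le> \<delta>"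
  shows "(\<Sum>C\<in>D. exp (birkhoff_sum f (\<lambda>z. \<psi> z - c * indicator (\<Union>A\<in>\<xi>. A - B A) z) n (x C)))
    \<le> exp (real n * (2 * \<epsilon>)) * (\<Sum>y\<in>E. exp (birkhoff_sum f \<psi> n y))"
proof -
  define U where "U = (\<Union>A\<in>\<xi>. A - B A)"
  define \<theta> where "\<theta> = exp (- c)"
  have \<theta>: "\<theta> > 0" "\<theta> \<le> 1" using c by (auto simp: \<theta>_def)
  have \<xi>': "finite \<xi>" using \<xi> by (simp add: borel_partition_def)
  have "\<exists>y\<in>E. \<forall>i<n. dist ((f ^^ i) (x C)) ((f ^^ i) y) \<le> \<delta>" for C by (rule E(2))
  then obtain y where y: "\<And>C. y C \<in> E" "\<And>C i. i < n \<Longrightarrow> dist ((f ^^ i) (x C)) ((f ^^ i) (y C)) \<le> \<delta>"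
    by metis
  have "\<exists>A\<in>{..<n} \<rightarrow>\<^sub>E \<xi>. C = (\<Inter>i<n. (f ^^ i) -` A i)" if "C \<in> D" for C
    using iterated_join_word[of C f \<xi> n] D(1) that by blast
  then obtain W where W: "\<And>C. C \<in> D \<Longrightarrow> W C \<in> {..<n} \<rightarrow>\<^sub>E \<xi>"
      "\<And>C. C \<in> D \<Longrightarrow> C = (\<Inter>i<n. (f ^^ i) -` W C i)"
    by metis
  \<comment> \<open>The weight of the atom \<open>A\<close> at a time when the shadowing orbit is at \<open>z\<close>.\<close>
  define v where "v z A = (if \<exists>b\<in>B A. dist b z \<le> \<delta> then 1 else \<theta>)" for z A
  have v0: "v z A > 0" for z A using \<theta> by (simp add: v_def)
  \<comment> \<open>At most one atom has weight one: the sets \<open>B A\<close> of two such atoms would be closer than \<open>d\<close>.\<close>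
  have vsum: "(\<Sum>A\<in>\<xi>. v z A) \<le> exp \<epsilon>" for z
  proof -
    define S where "S = {A \<in> \<xi>. \<exists>b\<in>B A. dist b z \<le> \<delta>}"
    have "A = A'" if AA': "A \<in> S" "A' \<in> S" for A A'
    proof -
      obtain b b' where b: "b \<in> B A" "dist b z \<le> \<delta>" "b' \<in> B A'" "dist b' z \<le> \<delta>"
        using AA' unfolding S_def by blast
      then have "dist b b' < d" using dist_triangle2[of b b' z] \<delta> by simp
      with b AA' show ?thesis using sep by (auto simp: S_def)
    qed
    then have cS: "card S \<le> 1"
      using \<xi>' by (subst card_le_Suc0_iff_eq[unfolded One_nat_def[symmetric]]) (auto simp: S_def)
    have "(\<Sum>A\<in>\<xi>. v z A) \<le> (\<Sum>A\<in>\<xi>. indicator S A + \<theta>)"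
      by (rule sum_mono) (use \<theta> in \<open>auto simp: v_def S_def indicator_def\<close>)
    also have "\<dots> = real (card S) + real (card \<xi>) * \<theta>"
    proof -
      have "(\<Sum>A\<in>\<xi>. indicator S A) = real (card S)"
        using \<xi>' by (simp add: S_def indicator_def sum.If_cases Int_def)
      then show ?thesis by (simp add: sum.distrib)
    qed
    also have "\<dots> \<le> 1 + \<epsilon>" using cS c(2) by (simp add: \<theta>_def)
    also have "\<dots> \<le> exp \<epsilon>" by (rule exp_ge_add_one_self)
    finally show ?thesis .
  qed
  have weight: "exp (\<psi> z - c * indicator U z) \<le> exp \<epsilon> * exp (\<psi> z') * v z' A"
    if zA: "z \<in> A" "A \<in> \<xi>" "dist z z' \<le> \<delta>" for z z' A
  proof -
    have "exp (\<psi> z) \<le> exp \<epsilon> * exp (\<psi> z')"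
      using unif[OF zA(3)] by (simp add: exp_add[symmetric])
    moreover have "exp (- (c * indicator U z)) \<le> v z' A"
    proof (cases "z \<in> B A")
      case True
      then have "v z' A = 1" using zA by (auto simp: v_def)
      then show ?thesis using c(1) by (simp add: indicator_def)
    next
      case False
      then have "z \<in> U" using zA by (auto simp: U_def)
      then show ?thesis using \<theta> by (simp add: v_def \<theta>_def)
    qed
    ultimately have "exp (\<psi> z) * exp (- (c * indicator U z)) \<le> (exp \<epsilon> * exp (\<psi> z')) * v z' A"
      by (intro mult_mono) auto
    then show ?thesis by (simp add: exp_diff exp_minus field_simps)
  qed
  have pointwise: "exp (birkhoff_sum f (\<lambda>z. \<psi> z - c * indicator U z) n (x C))
      \<le> exp (real n * \<epsilon>) * exp (birkhoff_sum f \<psi> n (y C)) * (\<Prod>i<n. v ((f ^^ i) (y C)) (W C i))"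
    if C: "C \<in> D" for C
  proof -
    have "exp (birkhoff_sum f (\<lambda>z. \<psi> z - c * indicator U z) n (x C))
        = (\<Prod>i<n. exp (\<psi> ((f ^^ i) (x C)) - c * indicator U ((f ^^ i) (x C))))"
      by (simp add: birkhoff_sum_def exp_sum)
    also have "\<dots> \<le> (\<Prod>i<n. exp \<epsilon> * exp (\<psi> ((f ^^ i) (y C))) * v ((f ^^ i) (y C)) (W C i))"
    proof (rule prod_mono, intro conjI weight)
      fix i assume i: "i \<in> {..<n}"
      show "(f ^^ i) (x C) \<in> W C i" using D(3)[OF C] W(2)[OF C] i by blast
      show "W C i \<in> \<xi>" using W(1)[OF C] i by auto
      show "dist ((f ^^ i) (x C)) ((f ^^ i) (y C)) \<le> \<delta>" using y(2) i by simp
    qed simp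
    also have "\<dots> = exp (real n * \<epsilon>) * exp (birkhoff_sum f \<psi> n (y C)) * (\<Prod>i<n. v ((f ^^ i) (y C)) (W C i))"
      by (simp add: prod.distrib birkhoff_sum_def exp_sum exp_of_nat_mult)
    finally show ?thesis .
  qed
  \<comment> \<open>A cell is determined by its itinerary, and the sum over all itineraries factorizes over time.\<close>
  have words: "(\<Sum>C\<in>{C \<in> D. y C = e}. \<Prod>i<n. v ((f ^^ i) (y C)) (W C i)) \<le> exp (real n * \<epsilon>)" for e
  proof -
    have "(\<Sum>C\<in>{C \<in> D. y C = e}. \<Prod>i<n. v ((f ^^ i) (y C)) (W C i))
        = (\<Sum>w\<in>W ` {C \<in> D. y C = e}. \<Prod>i<n. v ((f ^^ i) e) (w i))"
    proof (subst sum.reindex)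
      show "inj_on W {C \<in> D. y C = e}"
      proof (rule inj_onI)
        fix C C' assume C: "C \<in> {C \<in> D. y C = e}" "C' \<in> {C \<in> D. y C = e}" and eq: "W C = W C'"
        have "C = (\<Inter>i<n. (f ^^ i) -` W C i)" by (rule W(2)) (use C in simp)
        also have "\<dots> = (\<Inter>i<n. (f ^^ i) -` W C' i)" using eq by simp
        also have "\<dots> = C'" by (rule W(2)[symmetric]) (use C in simp)
        finally show "C = C'" .
      qed
    qed (auto intro: sum.cong)
    also have "\<dots> \<le> (\<Sum>w\<in>{..<n} \<rightarrow>\<^sub>E \<xi>. \<Prod>i<n. v ((f ^^ i) e) (w i))"
    proof (rule sum_mono2)
      show "finite ({..<n} \<rightarrow>\<^sub>E \<xi>)" using \<xi>' by (intro finite_PiE) auto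
      show "W ` {C \<in> D. y C = e} \<subseteq> {..<n} \<rightarrow>\<^sub>E \<xi>" using W(1) by blast
      show "0 \<le> (\<Prod>i<n. v ((f ^^ i) e) (w i))" for w
        by (intro prod_nonneg ballI less_imp_le v0)
    qed
    also have "\<dots> = (\<Prod>i<n. \<Sum>A\<in>\<xi>. v ((f ^^ i) e) A)"
      using \<xi>' by (intro prod_sum_PiE[symmetric]) auto
    also have "\<dots> \<le> (\<Prod>i<n. exp \<epsilon>)"
      using vsum v0 by (intro prod_mono conjI sum_nonneg) (auto intro: less_imp_le)
    also have "\<dots> = exp (real n * \<epsilon>)" by (simp add: exp_of_nat_mult)
    finally show ?thesis .
  qed
  have "(\<Sum>C\<in>D. exp (birkhoff_sum f (\<lambda>z. \<psi> z - c * indicator U z) n (x C)))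
      \<le> (\<Sum>C\<in>D. exp (real n * \<epsilon>) * exp (birkhoff_sum f \<psi> n (y C)) * (\<Prod>i<n. v ((f ^^ i) (y C)) (W C i)))"
    by (intro sum_mono pointwise)
  also have "\<dots> = (\<Sum>e\<in>E. \<Sum>C\<in>{C \<in> D. y C = e}.
      exp (real n * \<epsilon>) * exp (birkhoff_sum f \<psi> n (y C)) * (\<Prod>i<n. v ((f ^^ i) (y C)) (W C i)))"
    by (rule sum.group[symmetric]) (use D(2) E(1) y(1) in auto)
  also have "\<dots> = (\<Sum>e\<in>E. exp (real n * \<epsilon>) * exp (birkhoff_sum f \<psi> n e) *
      (\<Sum>C\<in>{C \<in> D. y C = e}. \<Prod>i<n. v ((f ^^ i) (y C)) (W C i)))"
    by (intro sum.cong refl) (simp add: sum_distrib_left)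
  also have "\<dots> \<le> (\<Sum>e\<in>E. exp (real n * \<epsilon>) * exp (birkhoff_sum f \<psi> n e) * exp (real n * \<epsilon>))"
    by (intro sum_mono mult_left_mono words) simp
  also have "\<dots> = exp (real n * (2 * \<epsilon>)) * (\<Sum>e\<in>E. exp (birkhoff_sum f \<psi> n e))"
    unfolding sum_distrib_left by (intro sum.cong refl) (simp add: exp_add[symmetric])
  finally show ?thesis by (simp add: U_def)
qed

text \<open>
  An error \<open>\<epsilon>' = 3 * \<epsilon>\<close> is allowed and then removed. The parameters are chosen in this order: the
  penalty \<open>c\<close>, large enough to pay for the choice of an atom; then compact sets \<open>B A \<subseteq> A\<close> missing so
  little mass that the penalty costs at most \<open>\<epsilon>\<close> on average; then the scale \<open>\<delta>\<close>, small compared with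
  the distances between the sets \<open>B A\<close> and so small that \<open>\<psi>\<close> oscillates by at most \<open>\<epsilon>\<close> at this
  scale. The three losses of at most \<open>\<epsilon>\<close> per unit of time are the mean penalty, the oscillation of
  \<open>\<psi>\<close> and the choice of atoms.
\<close>

lemma ks_entropy_partition_plus_integral_le:
  fixes f :: "'a::metric_space \<Rightarrow> 'a" and \<psi> :: "'a \<Rightarrow> real"
  assumes cpt: "compact (UNIV :: 'a set)" and cf: "continuous_on UNIV f" and c\<psi>: "continuous_on UNIV \<psi>"
    and inv: "\<mu> \<in> invariant_measures f" and \<xi>: "borel_partition \<xi>"
  shows "ks_entropy_partition f \<mu> \<xi> + ereal (integral\<^sup>L \<mu> \<psi>) \<le> topological_pressure f \<psi>"
proof (rule ereal_le_epsilon2)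
  fix \<epsilon>' :: real assume "\<epsilon>' > 0"
  define \<epsilon> where "\<epsilon> = \<epsilon>' / 3"
  have \<epsilon>: "\<epsilon> > 0" using \<open>\<epsilon>' > 0\<close> by (simp add: \<epsilon>_def)
  interpret prob_space \<mu> using inv by (simp add: invariant_measures_def)
  have sets: "sets \<mu> = sets borel" using inv by (simp add: invariant_measures_def)
  have \<xi>': "finite \<xi>" "\<xi> \<subseteq> sets borel" "\<Union>\<xi> = UNIV" "disjoint \<xi>"
    using \<xi> by (auto simp: borel_partition_def partition_on_def)
  then have k: "card \<xi> > 0" by (auto simp: card_gt_0_iff)
  define c where "c = max 0 (ln (real (card \<xi>) / \<epsilon>))"
  have c: "c \<ge> 0" "real (card \<xi>) * exp (- c) \<le> \<epsilon>"
  proof -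
    have "exp (- c) \<le> exp (- ln (real (card \<xi>) / \<epsilon>))" by (simp add: c_def)
    also have "\<dots> = \<epsilon> / real (card \<xi>)" using k \<epsilon> by (simp add: exp_minus)
    finally show "real (card \<xi>) * exp (- c) \<le> \<epsilon>" using k by (simp add: field_simps)
  qed (simp add: c_def)
  have "\<exists>K. compact K \<and> K \<subseteq> A \<and> measure \<mu> (A - K) < \<epsilon> / (real (card \<xi>) * (c + 1))" if "A \<in> \<xi>" for A
    using compact_inner_regular[OF cpt prob_space_axioms sets, of A "\<epsilon> / (real (card \<xi>) * (c + 1))"]
      that \<xi>'(2) \<epsilon> k c(1) by (metis divide_pos_pos add_nonneg_pos mult_pos_pos of_nat_0_less_iff subsetD zero_less_one)
  then obtain B where B: "\<And>A. A \<in> \<xi> \<Longrightarrow> compact (B A)" "\<And>A. A \<in> \<xi> \<Longrightarrow> B A \<subseteq> A"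
      "\<And>A. A \<in> \<xi> \<Longrightarrow> measure \<mu> (A - B A) < \<epsilon> / (real (card \<xi>) * (c + 1))"
    by metis
  define U where "U = (\<Union>A\<in>\<xi>. A - B A)"
  have mAB: "A - B A \<in> sets borel" if "A \<in> \<xi>" for A
    using \<xi>'(2) that compact_imp_closed[OF B(1)[OF that]] by auto
  have mU: "U \<in> sets borel" unfolding U_def using \<xi>'(1) mAB by auto
  have "measure \<mu> U \<le> (\<Sum>A\<in>\<xi>. measure \<mu> (A - B A))"
    unfolding U_def using \<xi>'(1) mAB sets by (intro finite_measure_subadditive_finite) auto
  also have "\<dots> \<le> real (card \<xi>) * (\<epsilon> / (real (card \<xi>) * (c + 1)))"
    using B(3) by (intro sum_bounded_above) (simp add: less_imp_le)
  also have "\<dots> = \<epsilon> / (c + 1)" using k by simp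
  finally have "(c + 1) * measure \<mu> U \<le> \<epsilon>" using c(1) by (simp add: field_simps)
  moreover have "c * measure \<mu> U \<le> (c + 1) * measure \<mu> U" by (simp add: algebra_simps)
  ultimately have cU: "c * measure \<mu> U \<le> \<epsilon>" by linarith
  have disjB: "B A \<inter> B A' = {}" if "A \<in> \<xi>" "A' \<in> \<xi>" "A \<noteq> A'" for A A'
  proof -
    have "A \<inter> A' = {}" using \<xi>'(4) that unfolding disjoint_def by simp
    then show ?thesis using B(2)[OF that(1)] B(2)[OF that(2)] by blast
  qed
  obtain d where d: "d > 0"
      "\<And>A A' x y. A \<in> \<xi> \<Longrightarrow> A' \<in> \<xi> \<Longrightarrow> x \<in> B A \<Longrightarrow> y \<in> B A' \<Longrightarrow> dist x y < d \<Longrightarrow> A = A'"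
    by (rule finite_disjoint_compacts_positive_distance[of \<xi> B]) (use \<xi>'(1) B(1) disjB in auto)
  have "uniformly_continuous_on UNIV \<psi>" using compact_uniformly_continuous[OF c\<psi> cpt] .
  then obtain d' where d': "d' > 0" "\<And>x y. dist x y < d' \<Longrightarrow> dist (\<psi> x) (\<psi> y) < \<epsilon>"
    unfolding uniformly_continuous_on_def using \<epsilon> by (metis UNIV_I dist_commute)
  define \<delta> where "\<delta> = min (d / 3) (d' / 2)"
  have \<delta>: "\<delta> > 0" "2 * \<delta> < d" "\<delta> < d'" using d(1) d'(1) by (auto simp: \<delta>_def)
  have unif: "\<bar>\<psi> x - \<psi> y\<bar> \<le> \<epsilon>" if "dist x y \<le> \<delta>" for x y
    using d'(2)[of x y] that \<delta>(3) by (simp add: dist_real_def)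
  obtain M where M: "\<And>x. \<bar>\<psi> x\<bar> \<le> M"
    using compact_imp_bounded[OF compact_continuous_image[OF c\<psi> cpt]] by (auto simp: bounded_iff)
  define S where "S n = (SUP E\<in>separated_sets f n \<delta>. \<Sum>x\<in>E. exp (birkhoff_sum f \<psi> n x))" for n
  define H where "H n = partition_entropy \<mu> (iterated_join f \<xi> n)" for n
  have bound: "H n / real n + integral\<^sup>L \<mu> \<psi> \<le> ln (S n) / real n + \<epsilon>'" if n: "n > 0" for n
  proof -
    define g where "g z = \<psi> z - c * indicator U z" for z
    have m\<psi>: "\<psi> \<in> borel_measurable borel" using c\<psi> by (rule borel_measurable_continuous_onI)
    have mg: "g \<in> borel_measurable borel"
      unfolding g_def using m\<psi> mU by measurable
    have bg: "\<bar>g z\<bar> \<le> M + c" for z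
      using M[of z] c(1) by (auto simp: g_def indicator_def abs_le_iff)
    have m\<psi>': "\<psi> \<in> borel_measurable \<mu>" using m\<psi> sets by (simp cong: measurable_cong_sets)
    have i\<psi>: "integrable \<mu> \<psi>"
      by (rule integrable_const_bound[where B = M]) (use M m\<psi>' in auto)
    have iU: "integrable \<mu> (\<lambda>z. c * indicator U z)"
      using integrable_real_mult_indicator[of U \<mu> "\<lambda>_. c"] mU sets by simp
    have "integral\<^sup>L \<mu> g = integral\<^sup>L \<mu> \<psi> - c * measure \<mu> U"
      unfolding g_def using i\<psi> iU mU sets sets.sets_into_space[of U \<mu>]
      by (subst Bochner_Integration.integral_diff) (auto simp: Int_absorb2)
    then have ig: "integral\<^sup>L \<mu> g \<ge> integral\<^sup>L \<mu> \<psi> - \<epsilon>" using cU by simp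
    obtain D x where D: "D \<subseteq> iterated_join f \<xi> n" "D \<noteq> {}" "\<And>C. C \<in> D \<Longrightarrow> x C \<in> C"
        "H n + integral\<^sup>L \<mu> (birkhoff_sum f g n) \<le> ln (\<Sum>C\<in>D. exp (birkhoff_sum f g n (x C)))"
      by (rule entropy_plus_integral_le[OF prob_space_axioms sets iterated_join_partition[OF cf \<xi>, of n]
            integral_birkhoff_sum(2)[OF cf inv mg bg, of n]])
        (rule that, auto simp: H_def)
    have fD: "finite D"
      using finite_subset[OF D(1)] iterated_join_partition[OF cf \<xi>] by (simp add: borel_partition_def)
    obtain E where E: "E \<in> separated_sets f n \<delta>"
        "\<And>z. \<exists>y\<in>E. \<forall>i<n. dist ((f ^^ i) z) ((f ^^ i) y) \<le> \<delta>"
      using maximal_separated_set[OF cpt cf \<delta>(1)] by blast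
    have "finite E" "E \<noteq> {}" using E by (auto simp: separated_sets_def)
    then have Epos: "(\<Sum>y\<in>E. exp (birkhoff_sum f \<psi> n y)) > 0" by (intro sum_pos) auto
    have ES: "(\<Sum>y\<in>E. exp (birkhoff_sum f \<psi> n y)) \<le> S n"
      unfolding S_def by (rule separated_sum_le_SUP[OF cpt cf \<delta>(1) M E(1)])
    have "(\<Sum>C\<in>D. exp (birkhoff_sum f g n (x C)))
        \<le> exp (real n * (2 * \<epsilon>)) * (\<Sum>y\<in>E. exp (birkhoff_sum f \<psi> n y))"
      unfolding g_def U_def
      by (rule shadow_sum_le[OF \<xi> B(2) d(2) \<delta>(2) unif c D(1) fD D(3) \<open>finite E\<close> E(2)])
    also have "\<dots> \<le> exp (real n * (2 * \<epsilon>)) * S n" using ES by simp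
    finally have le: "(\<Sum>C\<in>D. exp (birkhoff_sum f g n (x C))) \<le> exp (real n * (2 * \<epsilon>)) * S n" .
    have Spos: "S n > 0" using Epos ES by simp
    have "H n + real n * integral\<^sup>L \<mu> g \<le> real n * (2 * \<epsilon>) + ln (S n)"
    proof -
      have "(\<Sum>C\<in>D. exp (birkhoff_sum f g n (x C))) > 0" using fD D(2) by (intro sum_pos) auto
      then have "ln (\<Sum>C\<in>D. exp (birkhoff_sum f g n (x C))) \<le> ln (exp (real n * (2 * \<epsilon>)) * S n)"
        using le by (intro ln_mono) auto
      also have "\<dots> = real n * (2 * \<epsilon>) + ln (S n)" using Spos by (simp add: ln_mult)
      finally show ?thesis
        using D(4) integral_birkhoff_sum(1)[OF cf inv mg bg] by simp
    qed
    moreover have "real n * (integral\<^sup>L \<mu> \<psi> - \<epsilon>) \<le> real n * integral\<^sup>L \<mu> g"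
      using ig by (intro mult_left_mono) auto
    ultimately have "H n + real n * integral\<^sup>L \<mu> \<psi> \<le> ln (S n) + real n * \<epsilon>'"
      by (simp add: \<epsilon>_def algebra_simps)
    then have "(H n + real n * integral\<^sup>L \<mu> \<psi>) / real n \<le> (ln (S n) + real n * \<epsilon>') / real n"
      by (rule divide_right_mono) simp
    then show ?thesis using n by (simp add: add_divide_distrib)
  qed
  have "ks_entropy_partition f \<mu> \<xi> + ereal (integral\<^sup>L \<mu> \<psi>) = limsup (\<lambda>n. ereal (H n / real n) + ereal (integral\<^sup>L \<mu> \<psi>))"
    unfolding ks_entropy_partition_def H_def by (rule Limsup_add_ereal_right[symmetric]) auto
  also have "\<dots> \<le> limsup (\<lambda>n. ereal (ln (S n) / real n) + ereal \<epsilon>')"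
    using bound by (intro Limsup_mono eventually_mono[OF eventually_gt_at_top[of 0]]) simp
  also have "\<dots> = limsup (\<lambda>n. ereal (ln (S n) / real n)) + ereal \<epsilon>'"
    by (rule Limsup_add_ereal_right) auto
  also have "\<dots> \<le> topological_pressure f \<psi> + ereal \<epsilon>'"
    unfolding topological_pressure_def S_def using \<delta>(1) by (intro add_right_mono SUP_upper) simp
  finally show "ks_entropy_partition f \<mu> \<xi> + ereal (integral\<^sup>L \<mu> \<psi>) \<le> topological_pressure f \<psi> + ereal \<epsilon>'" .
qed

theorem measure_pressure_le_topological_pressure:
  fixes f :: "'a::metric_space \<Rightarrow> 'a" and \<psi> :: "'a \<Rightarrow> real"
  assumes "compact (UNIV :: 'a set)" and "continuous_on UNIV f" and "continuous_on UNIV \<psi>"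
    and "\<mu> \<in> invariant_measures f"
  shows "measure_pressure f \<psi> \<mu> \<le> topological_pressure f \<psi>"
proof -
  have "ks_entropy f \<mu> \<le> topological_pressure f \<psi> - ereal (integral\<^sup>L \<mu> \<psi>)"
    unfolding ks_entropy_def
    by (rule SUP_least, subst ereal_le_minus) (use ks_entropy_partition_plus_integral_le[OF assms] in auto)
  then show ?thesis
    unfolding measure_pressure_def by (subst (asm) ereal_le_minus) auto
qed

section \<open>Entropy of mixtures and ergodicity of extreme measures\<close>

lemma partition_entropy_nonneg:
  assumes "prob_space \<mu>"
  shows "0 \<le> partition_entropy \<mu> P"
proof -
  interpret prob_space \<mu> by fact
  have "measure \<mu> A * ln (measure \<mu> A) \<le> 0" for A
    using prob_le_1[of A] measure_nonneg[of \<mu> A]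
    by (cases "measure \<mu> A = 0") (auto intro!: mult_nonneg_nonpos simp: ln_le_zero_iff zero_less_measure_iff)
  then show ?thesis unfolding partition_entropy_def by (simp add: sum_nonpos)
qed

lemma ks_entropy_partition_nonneg:
  assumes "prob_space \<mu>"
  shows "0 \<le> ks_entropy_partition f \<mu> P"
proof -
  have "0 = limsup (\<lambda>n. 0 :: ereal)" by (simp add: Limsup_const)
  also have "\<dots> \<le> ks_entropy_partition f \<mu> P"
    unfolding ks_entropy_partition_def
    by (intro Limsup_mono always_eventually allI) (simp add: partition_entropy_nonneg[OF assms])
  finally show ?thesis .
qed

lemma ks_entropy_partition_le: "borel_partition P \<Longrightarrow> ks_entropy_partition f \<mu> P \<le> ks_entropy f \<mu>"
  unfolding ks_entropy_def by (rule SUP_upper) simp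

lemma ks_entropy_nonneg:
  fixes f :: "'a::metric_space \<Rightarrow> 'a"
  assumes "prob_space \<mu>"
  shows "0 \<le> ks_entropy f \<mu>"
proof -
  have "borel_partition {UNIV :: 'a set}"
    by (simp add: borel_partition_def partition_on_def)
  from ks_entropy_partition_nonneg[OF assms] ks_entropy_partition_le[OF this]
  show ?thesis by (rule order_trans)
qed

text \<open>
  Both values \<open>x ln x\<close> and \<open>y ln y\<close> are compared with the tangent at the midpoint.
\<close>

lemma x_ln_x_midpoint_convex:
  fixes x y :: real
  assumes "0 \<le> x" "0 \<le> y"
  shows "((x + y) / 2) * ln ((x + y) / 2) \<le> (x * ln x + y * ln y) / 2"
proof -
  define m where "m = (x + y) / 2"
  have tangent: "z * ln m \<le> z * ln z + (m - z)" if "0 \<le> z" "m > 0" for z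
  proof (cases "z = 0")
    case False
    with that have z: "z > 0" by simp
    have "z * (ln m - ln z) = z * ln (m / z)" using z that by (simp add: ln_div)
    also have "\<dots> \<le> z * (m / z - 1)"
      using z that by (intro mult_left_mono ln_le_minus_one) auto
    also have "\<dots> = m - z" using z by (simp add: field_simps)
    finally show ?thesis by (simp add: right_diff_distrib)
  qed (use that in simp)
  show ?thesis
  proof (cases "m = 0")
    case True
    with assms have "x = 0" "y = 0" by (auto simp: m_def)
    then show ?thesis by simp
  next
    case False
    with assms have "m > 0" by (simp add: m_def)
    have "x * ln m + y * ln m \<le> x * ln x + y * ln y"
    proof -
      have "m + m = x + y" by (simp add: m_def)
      then show ?thesis
        using tangent[OF assms(1) \<open>m > 0\<close>] tangent[OF assms(2) \<open>m > 0\<close>] by linarith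
    qed
    then show ?thesis unfolding m_def[symmetric] by (simp add: m_def field_simps)
  qed
qed

text \<open>
  A reverse of convexity: the logarithm of a sum of positive numbers is at least that of each of
  them. The defect is linear in \<open>x\<close> and \<open>y\<close>, so over a partition it sums to a constant.
\<close>

lemma x_ln_x_convex_combination_ge:
  fixes x y :: real
  assumes "0 \<le> x" "0 \<le> y" "0 < p" "0 < q"
  shows "p * (x * ln x) + q * (y * ln y) + x * (p * ln p) + y * (q * ln q)
    \<le> (p * x + q * y) * ln (p * x + q * y)"
proof -
  have partwise: "u * ln u \<le> u * ln (u + v)" if "0 \<le> u" "0 \<le> v" for u v :: real
    using that by (cases "u = 0") (auto intro!: mult_left_mono)
  have leibniz: "r * (z * ln z) + z * (r * ln r) = (r * z) * ln (r * z)" if "0 \<le> z" "0 < r" for r z :: real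
    using that by (cases "z = 0") (auto simp: ln_mult algebra_simps)
  have "(p * x) * ln (p * x) \<le> (p * x) * ln (p * x + q * y)"
    using assms by (intro partwise) auto
  moreover have "(q * y) * ln (q * y) \<le> (q * y) * ln (p * x + q * y)"
    using partwise[of "q * y" "p * x"] assms by (simp add: add.commute)
  ultimately show ?thesis
    using leibniz[OF assms(1,3)] leibniz[OF assms(2,4)] unfolding distrib_right by linarith
qed

text \<open>
  Concavity of the entropy at a midpoint, with the contribution of \<open>\<nu>\<close> dropped.
\<close>

lemma ks_entropy_le_twice_midpoint:
  fixes f :: "'a::metric_space \<Rightarrow> 'a"
  assumes "prob_space \<nu>"
    and cf: "continuous_on UNIV f"
    and mid: "\<And>A. A \<in> sets borel \<Longrightarrow> measure \<rho> A = (measure \<mu> A + measure \<nu> A) / 2"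
  shows "ks_entropy f \<mu> \<le> 2 * ks_entropy f \<rho>"
  unfolding ks_entropy_def[of f \<mu>]
proof (rule SUP_least)
  fix \<xi> :: "'a set set" assume "\<xi> \<in> {P. borel_partition P}"
  then have \<xi>: "borel_partition \<xi>" by simp
  have H: "partition_entropy \<mu> P \<le> 2 * partition_entropy \<rho> P" if P: "borel_partition P" for P
  proof -
    have "(\<Sum>A\<in>P. measure \<rho> A * ln (measure \<rho> A))
        \<le> (\<Sum>A\<in>P. (measure \<mu> A * ln (measure \<mu> A) + measure \<nu> A * ln (measure \<nu> A)) / 2)"
    proof (rule sum_mono)
      fix A assume "A \<in> P"
      then have "A \<in> sets borel" using P by (auto simp: borel_partition_def)
      then show "measure \<rho> A * ln (measure \<rho> A)
          \<le> (measure \<mu> A * ln (measure \<mu> A) + measure \<nu> A * ln (measure \<nu> A)) / 2"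
        using x_ln_x_midpoint_convex[of "measure \<mu> A" "measure \<nu> A"] by (simp add: mid)
    qed
    also have "\<dots> = - (partition_entropy \<mu> P + partition_entropy \<nu> P) / 2"
      by (simp add: partition_entropy_def sum.distrib sum_divide_distrib[symmetric])
    finally show ?thesis
      using partition_entropy_nonneg[OF assms(1), of P] unfolding partition_entropy_def[of \<rho>] by simp
  qed
  have "ks_entropy_partition f \<mu> \<xi>
      \<le> limsup (\<lambda>n. ereal 2 * ereal (partition_entropy \<rho> (iterated_join f \<xi> n) / real n))"
    unfolding ks_entropy_partition_def
    by (intro Limsup_mono always_eventually allI)
      (use H[OF iterated_join_partition[OF cf \<xi>]] in \<open>simp add: divide_right_mono\<close>)
  also have "\<dots> = ereal 2 * ks_entropy_partition f \<rho> \<xi>"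
    unfolding ks_entropy_partition_def by (rule limsup_ereal_mult_left) simp
  also have "\<dots> \<le> ereal 2 * ks_entropy f \<rho>"
    by (intro ereal_mult_left_mono ks_entropy_partition_le \<xi>) simp
  finally show "ks_entropy_partition f \<mu> \<xi> \<le> 2 * ks_entropy f \<rho>" by simp
qed

text \<open>
  The entropy of a partition with respect to a mixture exceeds the mixture of the entropies by at
  most the constant \<open>- p ln p - q ln q\<close>, which disappears after division by \<open>n\<close>.
\<close>

lemma ks_entropy_convex_combination_le:
  fixes f :: "'a::metric_space \<Rightarrow> 'a"
  assumes m1: "prob_space \<nu>\<^sub>1" "sets \<nu>\<^sub>1 = sets borel" and m2: "prob_space \<nu>\<^sub>2" "sets \<nu>\<^sub>2 = sets borel"
    and cf: "continuous_on UNIV f" and p: "0 < p" "0 < q"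
    and comb: "\<And>A. A \<in> sets borel \<Longrightarrow> measure \<mu> A = p * measure \<nu>\<^sub>1 A + q * measure \<nu>\<^sub>2 A"
  shows "ks_entropy f \<mu> \<le> ereal p * ks_entropy f \<nu>\<^sub>1 + ereal q * ks_entropy f \<nu>\<^sub>2"
  unfolding ks_entropy_def[of f \<mu>]
proof (rule SUP_least)
  fix \<xi> :: "'a set set" assume "\<xi> \<in> {P. borel_partition P}"
  then have \<xi>: "borel_partition \<xi>" by simp
  define c where "c = - (p * ln p + q * ln q)"
  let ?H = "\<lambda>\<nu> n. partition_entropy \<nu> (iterated_join f \<xi> n)"
  have H: "partition_entropy \<mu> P \<le> p * partition_entropy \<nu>\<^sub>1 P + q * partition_entropy \<nu>\<^sub>2 P + c"
    if P: "borel_partition P" for P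
  proof -
    have one: "(\<Sum>A\<in>P. measure \<nu>\<^sub>1 A) = 1" "(\<Sum>A\<in>P. measure \<nu>\<^sub>2 A) = 1"
      using sum_measure_partition(2)[OF m1 P, of "\<lambda>_. 0"] sum_measure_partition(2)[OF m2 P, of "\<lambda>_. 0"] by auto
    have "- (p * partition_entropy \<nu>\<^sub>1 P + q * partition_entropy \<nu>\<^sub>2 P + c)
        = p * (\<Sum>A\<in>P. measure \<nu>\<^sub>1 A * ln (measure \<nu>\<^sub>1 A)) + q * (\<Sum>A\<in>P. measure \<nu>\<^sub>2 A * ln (measure \<nu>\<^sub>2 A))
          + (\<Sum>A\<in>P. measure \<nu>\<^sub>1 A) * (p * ln p) + (\<Sum>A\<in>P. measure \<nu>\<^sub>2 A) * (q * ln q)"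
      using one by (simp add: partition_entropy_def c_def)
    also have "\<dots> = (\<Sum>A\<in>P. p * (measure \<nu>\<^sub>1 A * ln (measure \<nu>\<^sub>1 A)) + q * (measure \<nu>\<^sub>2 A * ln (measure \<nu>\<^sub>2 A))
          + measure \<nu>\<^sub>1 A * (p * ln p) + measure \<nu>\<^sub>2 A * (q * ln q))"
      by (simp only: sum.distrib sum_distrib_left sum_distrib_right)
    also have "\<dots> \<le> (\<Sum>A\<in>P. measure \<mu> A * ln (measure \<mu> A))"
    proof (rule sum_mono)
      fix A assume "A \<in> P"
      then have "A \<in> sets borel" using P by (auto simp: borel_partition_def)
      then show "p * (measure \<nu>\<^sub>1 A * ln (measure \<nu>\<^sub>1 A)) + q * (measure \<nu>\<^sub>2 A * ln (measure \<nu>\<^sub>2 A))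
          + measure \<nu>\<^sub>1 A * (p * ln p) + measure \<nu>\<^sub>2 A * (q * ln q) \<le> measure \<mu> A * ln (measure \<mu> A)"
        using x_ln_x_convex_combination_ge[of "measure \<nu>\<^sub>1 A" "measure \<nu>\<^sub>2 A", OF _ _ p]
        by (simp add: comb)
    qed
    finally show ?thesis unfolding partition_entropy_def[of \<mu>] by simp
  qed
  have "ks_entropy_partition f \<mu> \<xi>
      \<le> limsup (\<lambda>n. (ereal p * ereal (?H \<nu>\<^sub>1 n / real n) + ereal q * ereal (?H \<nu>\<^sub>2 n / real n)) + ereal (c / real n))"
    unfolding ks_entropy_partition_def
  proof (intro Limsup_mono always_eventually allI)
    fix n
    have "?H \<mu> n / real n \<le> (p * ?H \<nu>\<^sub>1 n + q * ?H \<nu>\<^sub>2 n + c) / real n"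
      by (intro divide_right_mono H iterated_join_partition[OF cf \<xi>]) simp
    then show "ereal (?H \<mu> n / real n)
        \<le> (ereal p * ereal (?H \<nu>\<^sub>1 n / real n) + ereal q * ereal (?H \<nu>\<^sub>2 n / real n)) + ereal (c / real n)"
      by (simp add: add_divide_distrib)
  qed
  also have "\<dots> \<le> limsup (\<lambda>n. ereal p * ereal (?H \<nu>\<^sub>1 n / real n) + ereal q * ereal (?H \<nu>\<^sub>2 n / real n))
      + limsup (\<lambda>n. ereal (c / real n))"
    by (rule ereal_limsup_add_mono)
  also have "limsup (\<lambda>n. ereal (c / real n)) = 0"
  proof (rule lim_imp_Limsup)
    have "(\<lambda>n. c / real n) \<longlonglongrightarrow> 0" by (rule lim_const_over_n)
    then show "(\<lambda>n. ereal (c / real n)) \<longlonglongrightarrow> 0" by (simp add: zero_ereal_def)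
  qed simp
  also have "limsup (\<lambda>n. ereal p * ereal (?H \<nu>\<^sub>1 n / real n) + ereal q * ereal (?H \<nu>\<^sub>2 n / real n)) + 0
      \<le> limsup (\<lambda>n. ereal p * ereal (?H \<nu>\<^sub>1 n / real n)) + limsup (\<lambda>n. ereal q * ereal (?H \<nu>\<^sub>2 n / real n))"
    unfolding add_0_right by (rule ereal_limsup_add_mono)
  also have "\<dots> = ereal p * ks_entropy_partition f \<nu>\<^sub>1 \<xi> + ereal q * ks_entropy_partition f \<nu>\<^sub>2 \<xi>"
    unfolding ks_entropy_partition_def using p by (simp only: limsup_ereal_mult_left less_imp_le)
  also have "\<dots> \<le> ereal p * ks_entropy f \<nu>\<^sub>1 + ereal q * ks_entropy f \<nu>\<^sub>2"
    using p by (intro add_mono ereal_mult_left_mono ks_entropy_partition_le \<xi>) auto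
  finally show "ks_entropy_partition f \<mu> \<xi> \<le> ereal p * ks_entropy f \<nu>\<^sub>1 + ereal q * ks_entropy f \<nu>\<^sub>2" .
qed

lemma invariant_measures_midpoint:
  fixes f :: "'a::metric_space \<Rightarrow> 'a"
  assumes cf: "continuous_on UNIV f"
    and \<mu>: "\<mu> \<in> invariant_measures f" and \<nu>: "\<nu> \<in> invariant_measures f"
  obtains \<rho> where "\<rho> \<in> invariant_measures f"
    "\<And>A. A \<in> sets borel \<Longrightarrow> measure \<rho> A = (measure \<mu> A + measure \<nu> A) / 2"
proof -
  interpret M: prob_space \<mu> using \<mu> by (simp add: invariant_measures_def)
  interpret N: prob_space \<nu> using \<nu> by (simp add: invariant_measures_def)
  have s: "sets \<mu> = sets borel" "sets \<nu> = sets borel"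
    and di: "distr \<mu> borel f = \<mu>" "distr \<nu> borel f = \<nu>"
    using \<mu> \<nu> by (auto simp: invariant_measures_def)
  have mf: "f \<in> measurable borel borel" using cf by (rule borel_measurable_continuous_onI)
  define w where "w A = ennreal (1/2) * (emeasure \<mu> A + emeasure \<nu> A)" for A
  define \<rho> where "\<rho> = measure_of UNIV (sets borel) w"
  have sa: "sigma_algebra UNIV (sets (borel :: 'a measure))"
    using sets.sigma_algebra_axioms[of "borel :: 'a measure"] by simp
  have s\<rho>: "sets \<rho> = sets borel"
    unfolding \<rho>_def using sigma_algebra.sets_measure_of_eq[OF sa] by simp
  have em: "emeasure \<rho> A = w A" if "A \<in> sets borel" for A
    unfolding \<rho>_def
  proof (rule emeasure_measure_of_sigma[OF sa _ _ that])
    show "positive (sets borel) w" by (simp add: positive_def w_def)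
    show "countably_additive (sets borel) w"
    proof (rule countably_additiveI)
      fix A :: "nat \<Rightarrow> 'a set"
      assume A: "range A \<subseteq> sets borel" "disjoint_family A"
      have "(\<Sum>i. w (A i)) = ennreal (1/2) * ((\<Sum>i. emeasure \<mu> (A i)) + (\<Sum>i. emeasure \<nu> (A i)))"
        unfolding w_def by (simp add: suminf_add[symmetric] del: ennreal_half)
      also have "\<dots> = w (\<Union>i. A i)"
        using A s by (simp add: w_def suminf_emeasure)
      finally show "(\<Sum>i. w (A i)) = w (\<Union>i. A i)" .
    qed
  qed
  have w: "w A = ennreal ((measure \<mu> A + measure \<nu> A) / 2)" for A
    unfolding w_def M.emeasure_eq_measure N.emeasure_eq_measure
    by (subst ennreal_plus[symmetric], simp, simp, subst ennreal_mult[symmetric]) auto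
  have sp: "space \<mu> = UNIV" "space \<nu> = UNIV" "space \<rho> = UNIV"
    using s s\<rho> by (auto dest: sets_eq_imp_space_eq)
  show thesis
  proof (rule that)
    have "emeasure \<rho> (space \<rho>) = 1"
      using em[of UNIV] M.prob_space N.prob_space by (simp add: w sp)
    then have "prob_space \<rho>" by (rule prob_spaceI)
    moreover have "distr \<rho> borel f = \<rho>"
    proof (rule measure_eqI)
      fix A assume "A \<in> sets (distr \<rho> borel f)"
      then have A: "A \<in> sets borel" by simp
      have fA: "f -` A \<in> sets borel" using measurable_sets[OF mf A] by simp
      have "measure \<mu> (f -` A) = measure \<mu> A" "measure \<nu> (f -` A) = measure \<nu> A"
        using measure_distr[of f \<mu> borel A] measure_distr[of f \<nu> borel A] mf s A di sp
        by (simp_all cong: measurable_cong_sets)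
      then show "emeasure (distr \<rho> borel f) A = emeasure \<rho> A"
        using mf s\<rho> A em[OF A] em[OF fA]
        by (subst emeasure_distr) (simp_all add: w sp cong: measurable_cong_sets)
    qed (simp add: s\<rho>)
    ultimately show "\<rho> \<in> invariant_measures f" using s\<rho> by (simp add: invariant_measures_def)
    show "measure \<rho> A = (measure \<mu> A + measure \<nu> A) / 2" if "A \<in> sets borel" for A
      using em[OF that] by (simp add: w measure_def)
  qed
qed

text \<open>
  Conditioning on an invariant set gives an invariant measure. The last two claims are written
  multiplied by the mass of \<open>A\<close>, the form in which the parts for \<open>A\<close> and \<open>- A\<close> add up.
\<close>

lemma invariant_measure_conditioned:
  fixes f :: "'a::metric_space \<Rightarrow> 'a"
  assumes cf: "continuous_on UNIV f" and \<mu>: "\<mu> \<in> invariant_measures f"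
    and A: "A \<in> sets borel" "f -` A = A" "measure \<mu> A > 0"
  shows "uniform_measure \<mu> A \<in> invariant_measures f"
    and "\<And>B. B \<in> sets borel \<Longrightarrow> measure \<mu> A * measure (uniform_measure \<mu> A) B = measure \<mu> (A \<inter> B)"
    and "\<And>g :: 'a \<Rightarrow> real. g \<in> borel_measurable borel \<Longrightarrow>
      measure \<mu> A * integral\<^sup>L (uniform_measure \<mu> A) g = integral\<^sup>L \<mu> (\<lambda>x. indicator A x * g x)"
proof -
  interpret M: prob_space \<mu> using \<mu> by (simp add: invariant_measures_def)
  have s: "sets \<mu> = sets borel" and di: "distr \<mu> borel f = \<mu>"
    using \<mu> by (auto simp: invariant_measures_def)
  have sp: "space \<mu> = UNIV" using s by (auto dest: sets_eq_imp_space_eq)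
  have mf: "f \<in> measurable borel borel" using cf by (rule borel_measurable_continuous_onI)
  have eA: "emeasure \<mu> A \<noteq> 0" "emeasure \<mu> A \<noteq> \<infinity>" using A(3) by (auto simp: M.emeasure_eq_measure)
  interpret U: prob_space "uniform_measure \<mu> A" by (rule prob_space_uniform_measure[OF eA])
  show m: "measure \<mu> A * measure (uniform_measure \<mu> A) B = measure \<mu> (A \<inter> B)" if "B \<in> sets borel" for B
    using that s A(3) by (subst measure_uniform_measure[OF eA]) auto
  have "distr (uniform_measure \<mu> A) borel f = uniform_measure \<mu> A"
  proof (rule measure_eqI)
    fix B assume "B \<in> sets (distr (uniform_measure \<mu> A) borel f)"
    then have B: "B \<in> sets borel" by simp
    have fB: "f -` B \<in> sets borel" using measurable_sets[OF mf B] by simp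
    have AB: "A \<inter> B \<in> sets borel" using A B by simp
    have "measure \<mu> (f -` (A \<inter> B)) = measure \<mu> (A \<inter> B)"
      using measure_distr[of f \<mu> borel "A \<inter> B"] mf s AB di sp by (simp cong: measurable_cong_sets)
    then have "measure \<mu> (A \<inter> f -` B) = measure \<mu> (A \<inter> B)"
      using A(2) by (simp add: vimage_Int)
    then have "measure (uniform_measure \<mu> A) (f -` B) = measure (uniform_measure \<mu> A) B"
      using m[OF fB] m[OF B] A(3) by (metis less_irrefl mult_left_cancel)
    then show "emeasure (distr (uniform_measure \<mu> A) borel f) B = emeasure (uniform_measure \<mu> A) B"
      using mf s B by (subst emeasure_distr) (simp_all add: sp U.emeasure_eq_measure
        cong: measurable_cong_sets del: emeasure_uniform_measure)
  qed (simp add: s)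
  then show "uniform_measure \<mu> A \<in> invariant_measures f"
    using s U.prob_space_axioms by (simp add: invariant_measures_def)
  fix g :: "'a \<Rightarrow> real" assume g: "g \<in> borel_measurable borel"
  have "uniform_measure \<mu> A = density \<mu> (\<lambda>x. ennreal (indicator A x / measure \<mu> A))"
    unfolding uniform_measure_def M.emeasure_eq_measure
    using A(3) by (intro arg_cong[where f = "density \<mu>"] ext)
      (auto simp: indicator_def divide_ennreal simp flip: ennreal_1)
  then have "integral\<^sup>L (uniform_measure \<mu> A) g = integral\<^sup>L \<mu> (\<lambda>x. (indicator A x / measure \<mu> A) *\<^sub>R g x)"
    using A s g by (simp only:) (intro integral_density, auto cong: measurable_cong_sets)
  also have "\<dots> = integral\<^sup>L \<mu> (\<lambda>x. indicator A x * g x / measure \<mu> A)" by simp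
  also have "\<dots> = integral\<^sup>L \<mu> (\<lambda>x. indicator A x * g x) / measure \<mu> A" by simp
  finally show "measure \<mu> A * integral\<^sup>L (uniform_measure \<mu> A) g = integral\<^sup>L \<mu> (\<lambda>x. indicator A x * g x)"
    using A(3) by simp
qed

text \<open>
  An invariant set of intermediate measure would split \<open>\<mu>\<close> into its two conditional measures, which
  differ on that set. The hypothesis may use the decomposition both of masses and of integrals, since
  entropy is computed from the former and the pressure also involves the latter.
\<close>

lemma extreme_invariant_measure_ergodic:
  fixes f :: "'a::metric_space \<Rightarrow> 'a"
  assumes cf: "continuous_on UNIV f" and cpt: "compact (UNIV :: 'a set)"
    and \<mu>: "\<mu> \<in> invariant_measures f"
    and extreme: "\<And>p q \<nu>\<^sub>1 \<nu>\<^sub>2. \<nu>\<^sub>1 \<in> invariant_measures f \<Longrightarrow> \<nu>\<^sub>2 \<in> invariant_measures f \<Longrightarrow>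
      0 < p \<Longrightarrow> 0 < q \<Longrightarrow> p + q = 1 \<Longrightarrow>
      (\<And>A. A \<in> sets borel \<Longrightarrow> measure \<mu> A = p * measure \<nu>\<^sub>1 A + q * measure \<nu>\<^sub>2 A) \<Longrightarrow>
      (\<And>g :: 'a \<Rightarrow> real. continuous_on UNIV g \<Longrightarrow>
        integral\<^sup>L \<mu> g = p * integral\<^sup>L \<nu>\<^sub>1 g + q * integral\<^sup>L \<nu>\<^sub>2 g) \<Longrightarrow> \<nu>\<^sub>1 = \<nu>\<^sub>2"
  shows "\<mu> \<in> ergodic_measures f"
proof -
  interpret prob_space \<mu> using \<mu> by (simp add: invariant_measures_def)
  have s: "sets \<mu> = sets borel" using \<mu> by (simp add: invariant_measures_def)
  have sp: "space \<mu> = UNIV" using s by (auto dest: sets_eq_imp_space_eq)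
  have "measure \<mu> A = 0 \<or> measure \<mu> A = 1" if A: "A \<in> sets borel" "f -` A = A" for A
  proof (rule ccontr)
    assume "\<not> ?thesis"
    then have p: "0 < measure \<mu> A" "measure \<mu> A < 1"
      by (simp_all add: less_le)
    have A': "- A \<in> sets borel" "f -` (- A) = - A" using A by (auto simp: Compl_in_sets_lebesgue)
    have q: "measure \<mu> (- A) = 1 - measure \<mu> A"
      using prob_compl[of A] A s sp by (simp add: Compl_eq_Diff_UNIV)
    then have q0: "measure \<mu> (- A) > 0" using p by simp
    note c1 = invariant_measure_conditioned[OF cf \<mu> A p(1)]
    note c2 = invariant_measure_conditioned[OF cf \<mu> A' q0]
    have "uniform_measure \<mu> A = uniform_measure \<mu> (- A)"
    proof (rule extreme[OF c1(1) c2(1) p(1) q0])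
      show "measure \<mu> A + measure \<mu> (- A) = 1" using q by simp
      show "measure \<mu> B = measure \<mu> A * measure (uniform_measure \<mu> A) B
          + measure \<mu> (- A) * measure (uniform_measure \<mu> (- A)) B" if B: "B \<in> sets borel" for B
      proof -
        have "measure \<mu> B = measure \<mu> ((A \<inter> B) \<union> (- A \<inter> B))" by (rule arg_cong) auto
        also have "\<dots> = measure \<mu> (A \<inter> B) + measure \<mu> (- A \<inter> B)"
          using A A' B s by (intro finite_measure_Union) auto
        finally show ?thesis using c1(2)[OF B] c2(2)[OF B] by simp
      qed
      fix g :: "'a \<Rightarrow> real" assume g: "continuous_on UNIV g"
      have mg: "g \<in> borel_measurable borel" using g by (rule borel_measurable_continuous_onI)
      then have mg': "g \<in> borel_measurable \<mu>" using s by (simp cong: measurable_cong_sets)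
      obtain M where M: "\<And>x. \<bar>g x\<bar> \<le> M"
        using compact_imp_bounded[OF compact_continuous_image[OF g cpt]] by (auto simp: bounded_iff)
      have ig: "integrable \<mu> g" by (rule integrable_const_bound[where B = M]) (use M mg' in auto)
      have int: "integrable \<mu> (\<lambda>x. indicator C x * g x)" if "C \<in> sets borel" for C
        using integrable_real_mult_indicator[of C \<mu> g] ig that s by (auto simp: mult.commute)
      have "integral\<^sup>L \<mu> g = integral\<^sup>L \<mu> (\<lambda>x. indicator A x * g x + indicator (- A) x * g x)"
        by (rule Bochner_Integration.integral_cong) (auto simp: indicator_def)
      also have "\<dots> = integral\<^sup>L \<mu> (\<lambda>x. indicator A x * g x) + integral\<^sup>L \<mu> (\<lambda>x. indicator (- A) x * g x)"
        by (rule Bochner_Integration.integral_add[OF int[OF A(1)] int[OF A'(1)]])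
      finally show "integral\<^sup>L \<mu> g = measure \<mu> A * integral\<^sup>L (uniform_measure \<mu> A) g
          + measure \<mu> (- A) * integral\<^sup>L (uniform_measure \<mu> (- A)) g"
        using c1(3)[OF mg] c2(3)[OF mg] by simp
    qed
    then have "measure (uniform_measure \<mu> A) A = measure (uniform_measure \<mu> (- A)) A" by simp
    moreover have "measure (uniform_measure \<mu> (- A)) A = 0" using c2(2)[OF A(1)] q0 by simp
    moreover have "measure (uniform_measure \<mu> A) A = 1" using c1(2)[OF A(1)] p by simp
    ultimately show False by simp
  qed
  then show ?thesis using \<mu> by (simp add: ergodic_measures_def)
qed

section \<open>Intermediate entropies\<close>

theorem theorem1p1:
  fixes f :: "'a::metric_space \<Rightarrow> 'a" and \<phi> :: "'a \<Rightarrow> real" and \<mu>\<^sub>\<phi> :: "'a measure"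
  assumes "compact (UNIV :: 'a set)"
    and "continuous_on UNIV f"
    and "upper_semicontinuous_map (weak_star_topology f) (ks_entropy f)"
    and "continuous_on UNIV \<phi>"
    and "\<And>t::real. t \<ge> 0 \<Longrightarrow> \<exists>!\<mu>. equilibrium_state f (\<lambda>x. t * \<phi> x) \<mu>"
    and "maximizing_measures f \<phi> = {\<mu>\<^sub>\<phi>}"
    and "ks_entropy f \<mu>\<^sub>\<phi> = 0"
  shows "intermediate_entropy_property f"
proof -
  note cpt = assms(1) and cf = assms(2) and usc = assms(3) and c\<phi> = assms(4)
  define J where "J \<mu> = integral\<^sup>L \<mu> \<phi>" for \<mu>
  define m where "m t = (THE \<mu>. equilibrium_state f (\<lambda>x. t * \<phi> x) \<mu>)" for t
  have eq: "equilibrium_state f (\<lambda>x. t * \<phi> x) (m t)" if "t \<ge> 0" for t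
    unfolding m_def by (rule theI'[OF assms(5)[OF that]])
  have uniq: "\<mu> = m t" if "t \<ge> 0" "equilibrium_state f (\<lambda>x. t * \<phi> x) \<mu>" for t \<mu>
    using assms(5)[OF that(1)] eq[OF that(1)] that(2) by blast
  have inv: "m t \<in> invariant_measures f" if "t \<ge> 0" for t
    using eq[OF that] by (simp add: equilibrium_state_def)
  have prob: "prob_space \<mu>" if "\<mu> \<in> invariant_measures f" for \<mu>
    using that by (simp add: invariant_measures_def)
  have pressure: "measure_pressure f (\<lambda>x. t * \<phi> x) \<mu> = ks_entropy f \<mu> + ereal (t * J \<mu>)" for t \<mu>
    by (simp add: measure_pressure_def J_def)
  have VP: "ks_entropy f \<mu> + ereal (t * J \<mu>) \<le> ks_entropy f (m t) + ereal (t * J (m t))"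
    if "\<mu> \<in> invariant_measures f" "t \<ge> 0" for \<mu> t
  proof -
    have "continuous_on UNIV (\<lambda>x. t * \<phi> x)" using c\<phi> by (intro continuous_intros)
    from measure_pressure_le_topological_pressure[OF cpt cf this that(1)] eq[OF that(2)]
    show ?thesis by (simp add: equilibrium_state_def pressure)
  qed
  have eqI: "\<mu> = m t" if "\<mu> \<in> invariant_measures f" "t \<ge> 0"
    "ks_entropy f \<mu> + ereal (t * J \<mu>) = ks_entropy f (m t) + ereal (t * J (m t))" for \<mu> t
    using uniq[OF that(2), of \<mu>] eq[OF that(2)] that by (simp add: equilibrium_state_def pressure)
  have \<mu>\<phi>: "\<mu>\<^sub>\<phi> \<in> invariant_measures f"
    using assms(6) by (auto simp: maximizing_measures_def)
  have top: "topological_entropy f = ks_entropy f (m 0)"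
  proof -
    have "topological_entropy f = topological_pressure f (\<lambda>x. 0 * \<phi> x)"
      by (simp add: topological_entropy_def topological_pressure_def birkhoff_sum_def)
    then show ?thesis using eq[of 0] pressure[of 0 "m 0"] by (simp add: equilibrium_state_def)
  qed
  obtain M where M: "\<And>x. \<bar>\<phi> x\<bar> \<le> M"
    using compact_imp_bounded[OF compact_continuous_image[OF c\<phi> cpt]] by (auto simp: bounded_iff)
  have JM: "\<bar>J \<mu>\<bar> \<le> M" if \<mu>: "\<mu> \<in> invariant_measures f" for \<mu>
  proof -
    interpret prob_space \<mu> using prob[OF \<mu>] .
    have "\<phi> \<in> borel_measurable \<mu>"
      using borel_measurable_continuous_onI[OF c\<phi>] \<mu>
      by (simp add: invariant_measures_def cong: measurable_cong_sets)
    then have "integrable \<mu> \<phi>" by (intro integrable_const_bound[where B = M]) (use M in auto)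
    then have "J \<mu> \<le> M" "- M \<le> J \<mu>"
      unfolding J_def using M by (auto intro!: integral_le_const integral_ge_const simp: abs_le_iff minus_le_iff)
    then show ?thesis by simp
  qed
  have J\<phi>: "J \<mu> \<le> J \<mu>\<^sub>\<phi>" if "\<mu> \<in> invariant_measures f" for \<mu>
  proof -
    have "bdd_above (J ` invariant_measures f)"
      using JM by (intro bdd_aboveI2[of _ _ M]) (auto simp: abs_le_iff)
    then have "J \<mu> \<le> (SUP \<nu>\<in>invariant_measures f. J \<nu>)" by (rule cSUP_upper[OF that])
    then show ?thesis using assms(6) by (auto simp: maximizing_measures_def J_def)
  qed
  have J\<phi>_unique: "\<mu> = \<mu>\<^sub>\<phi>" if \<mu>: "\<mu> \<in> invariant_measures f" "J \<mu> = J \<mu>\<^sub>\<phi>" for \<mu>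
  proof -
    have "\<mu>\<^sub>\<phi> \<in> maximizing_measures f \<phi>" using assms(6) by simp
    then have "\<mu> \<in> maximizing_measures f \<phi>" using \<mu> by (simp add: maximizing_measures_def J_def)
    then show ?thesis using assms(6) by simp
  qed
  \<comment> \<open>If \<open>m 0\<close> had infinite entropy, so would its midpoint with \<open>\<mu>\<^sub>\<phi>\<close>, against uniqueness at \<open>t = 0\<close>.\<close>
  have fin0: "ks_entropy f (m 0) \<noteq> \<infinity>"
  proof
    assume inf: "ks_entropy f (m 0) = \<infinity>"
    obtain \<rho> where \<rho>: "\<rho> \<in> invariant_measures f"
        "\<And>A. A \<in> sets borel \<Longrightarrow> measure \<rho> A = (measure (m 0) A + measure \<mu>\<^sub>\<phi> A) / 2"
      using invariant_measures_midpoint[OF cf inv[of 0] \<mu>\<phi>] by auto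
    have "ks_entropy f (m 0) \<le> 2 * ks_entropy f \<rho>"
      by (rule ks_entropy_le_twice_midpoint[OF prob[OF \<mu>\<phi>] cf \<rho>(2)])
    with inf have "ks_entropy f \<rho> = \<infinity>"
      by (cases "ks_entropy f \<rho>") (auto simp: numeral_eq_ereal)
    then have "\<rho> = m 0" by (intro eqI \<rho>) (simp_all add: inf)
    interpret m0: prob_space "m 0" using prob[OF inv[of 0]] by simp
    interpret mp: prob_space \<mu>\<^sub>\<phi> using prob[OF \<mu>\<phi>] .
    have "m 0 = \<mu>\<^sub>\<phi>"
    proof (rule measure_eqI)
      show "sets (m 0) = sets \<mu>\<^sub>\<phi>" using inv[of 0] \<mu>\<phi> by (simp add: invariant_measures_def)
      fix A assume "A \<in> sets (m 0)"
      then have "A \<in> sets borel" using inv[of 0] by (simp add: invariant_measures_def)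
      from \<rho>(2)[OF this] \<open>\<rho> = m 0\<close> show "emeasure (m 0) A = emeasure \<mu>\<^sub>\<phi> A"
        by (simp add: m0.emeasure_eq_measure mp.emeasure_eq_measure)
    qed
    with inf assms(7) show False by simp
  qed
  define k where "k \<mu> = real_of_ereal (ks_entropy f \<mu>)" for \<mu>
  have k: "ks_entropy f \<mu> = ereal (k \<mu>)" if \<mu>: "\<mu> \<in> invariant_measures f" for \<mu>
  proof -
    have "ks_entropy f \<mu> \<le> ks_entropy f (m 0)" using VP[OF \<mu>, of 0] by simp
    then have "ks_entropy f \<mu> \<noteq> \<infinity>" using fin0 by auto
    moreover have "ks_entropy f \<mu> \<noteq> -\<infinity>" using ks_entropy_nonneg[OF prob[OF \<mu>], of f] by auto
    ultimately show ?thesis by (cases "ks_entropy f \<mu>") (auto simp: k_def)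
  qed
  have k0: "k \<mu> \<ge> 0" if "\<mu> \<in> invariant_measures f" for \<mu>
    using ks_entropy_nonneg[OF prob[OF that], of f] k[OF that] by simp
  define P where "P t = k (m t) + t * J (m t)" for t
  have VPr: "k \<mu> + t * J \<mu> \<le> P t" if "\<mu> \<in> invariant_measures f" "t \<ge> 0" for \<mu> t
    using VP[OF that] k[OF that(1)] k[OF inv[OF that(2)]] by (simp add: P_def)
  have eqIr: "\<mu> = m t" if "\<mu> \<in> invariant_measures f" "t \<ge> 0" "P t \<le> k \<mu> + t * J \<mu>" for \<mu> t
    using VPr[OF that(1,2)] that(3) k[OF that(1)] k[OF inv[OF that(2)]]
    by (intro eqI that) (simp add: P_def)
  \<comment> \<open>The state \<open>m s\<close> competes at \<open>t\<close>, and the pressure of one measure is affine in the parameter.\<close>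
  have P_lip: "P s - P t \<le> M * \<bar>s - t\<bar>" if "s \<ge> 0" "t \<ge> 0" for s t
  proof -
    have "P s - P t \<le> (s - t) * J (m s)"
      using VPr[OF inv[OF that(1)] that(2)] by (simp add: P_def algebra_simps)
    also have "\<dots> \<le> \<bar>s - t\<bar> * \<bar>J (m s)\<bar>" by (metis abs_ge_self abs_mult)
    also have "\<dots> \<le> \<bar>s - t\<bar> * M" using JM[OF inv[OF that(1)]] by (intro mult_left_mono) auto
    finally show ?thesis by (simp add: mult.commute)
  qed
  have P_cont: "continuous_on {0..} P"
  proof (rule lipschitz_on_continuous_on)
    have "M \<ge> 0" using M[of undefined] by simp
    moreover have "dist (P s) (P t) \<le> M * dist s t" if "s \<ge> 0" "t \<ge> 0" for s t
      using P_lip[OF that] P_lip[OF that(2,1)] by (simp add: dist_real_def abs_le_iff abs_minus_commute)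
    ultimately show "M-lipschitz_on {0..} P" by (simp add: lipschitz_on_def)
  qed
  have P_seq: "(\<lambda>n. P (u n)) \<longlonglongrightarrow> P t" if "\<And>n. u n \<ge> 0" "t \<ge> 0" "u \<longlonglongrightarrow> t" for u t
    using P_cont that by (auto simp: continuous_on_sequentially o_def)
  \<comment> \<open>Upper semicontinuity makes a limit of equilibrium states an equilibrium state, and this is unique.\<close>
  have cluster: "\<exists>r. strict_mono (r :: nat \<Rightarrow> nat) \<and> (\<lambda>n. J (m (u (r n)))) \<longlonglongrightarrow> J (m t)"
    if u: "\<And>n. u n \<ge> 0" "t \<ge> 0" "u \<longlonglongrightarrow> t" for u t
  proof -
    obtain r \<nu> where r: "strict_mono (r :: nat \<Rightarrow> nat)" and \<nu>: "\<nu> \<in> invariant_measures f"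
      and conv: "\<And>g :: 'a \<Rightarrow> real. continuous_on UNIV g \<Longrightarrow> (\<lambda>n. integral\<^sup>L (m (u (r n))) g) \<longlonglongrightarrow> integral\<^sup>L \<nu> g"
      by (rule invariant_measures_seq_compact[OF cf cpt, of "\<lambda>n. m (u n)"]) (use inv u in auto)
    have JJ: "(\<lambda>n. J (m (u (r n)))) \<longlonglongrightarrow> J \<nu>" unfolding J_def by (rule conv[OF c\<phi>])
    have ur: "(\<lambda>n. u (r n)) \<longlonglongrightarrow> t" using LIMSEQ_subseq_LIMSEQ[OF u(3) r] by (simp add: o_def)
    have "(\<lambda>n. P (u (r n)) - u (r n) * J (m (u (r n)))) \<longlonglongrightarrow> P t - t * J \<nu>"
      using u by (intro tendsto_diff tendsto_mult JJ ur P_seq) auto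
    then have kk: "(\<lambda>n. k (m (u (r n)))) \<longlonglongrightarrow> P t - t * J \<nu>" by (simp add: P_def)
    have "P t - t * J \<nu> \<le> k \<nu>"
    proof (rule ccontr)
      assume "\<not> ?thesis"
      then obtain c where c: "k \<nu> < c" "c < P t - t * J \<nu>" using dense not_le by metis
      have "eventually (\<lambda>n. ks_entropy f (m (u (r n))) < ereal c) sequentially"
        by (rule usc_eventually_less[OF usc _ \<nu> conv]) (use inv u c k[OF \<nu>] in auto)
      then have "eventually (\<lambda>n. k (m (u (r n))) < c) sequentially"
        using k[OF inv[OF u(1)]] by simp
      moreover have "eventually (\<lambda>n. c < k (m (u (r n)))) sequentially"
        using order_tendstoD(1)[OF kk c(2)] .
      ultimately have "eventually (\<lambda>n. False) sequentially" by eventually_elim simp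
      then show False by simp
    qed
    then have "\<nu> = m t" by (intro eqIr \<nu> u) simp
    with r JJ show ?thesis by blast
  qed
  have J_cont: "continuous_on {0..} (\<lambda>t. J (m t))"
  proof (rule continuous_on_sequentiallyI, rule ccontr)
    fix u :: "nat \<Rightarrow> real" and t
    assume u: "\<forall>n. u n \<in> {0..}" "t \<in> {0..}" "u \<longlonglongrightarrow> t"
      and "\<not> (\<lambda>n. J (m (u n))) \<longlonglongrightarrow> J (m t)"
    then obtain e where e: "e > 0" "\<not> eventually (\<lambda>n. dist (J (m (u n))) (J (m t)) < e) sequentially"
      unfolding tendsto_iff by blast
    from not_eventually_sequentiallyD[OF e(2)]
    obtain r :: "nat \<Rightarrow> nat" where r: "strict_mono r" "\<And>n. \<not> dist (J (m (u (r n)))) (J (m t)) < e"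
      by blast
    have "(\<lambda>n. u (r n)) \<longlonglongrightarrow> t" using LIMSEQ_subseq_LIMSEQ[OF u(3) r(1)] by (simp add: o_def)
    then obtain s :: "nat \<Rightarrow> nat" where s: "(\<lambda>n. J (m (u (r (s n))))) \<longlonglongrightarrow> J (m t)"
      using cluster[of "\<lambda>n. u (r n)" t] u by auto
    have "eventually (\<lambda>n. dist (J (m (u (r (s n))))) (J (m t)) < e) sequentially"
      using tendstoD[OF s e(1)] .
    then have "eventually (\<lambda>n. False) sequentially" using r(2) by simp
    then show False by simp
  qed
  have k_cont: "continuous_on {0..} (\<lambda>t. k (m t))"
  proof -
    have "continuous_on {0..} (\<lambda>t. P t - t * J (m t))"
      by (intro continuous_intros P_cont J_cont)
    then show ?thesis by (simp add: P_def)
  qed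
  \<comment> \<open>As \<open>t\<close> grows, the bounded entropy term loses weight, so the states accumulate at \<open>\<mu>\<^sub>\<phi>\<close>.\<close>
  have k_small: "\<exists>T\<ge>0. k (m T) < a" if "a > 0" for a
  proof -
    define u where "u n = real (Suc n)" for n
    have u0: "u n \<ge> 0" for n by (simp add: u_def)
    obtain r \<nu> where r: "strict_mono (r :: nat \<Rightarrow> nat)" and \<nu>: "\<nu> \<in> invariant_measures f"
      and conv: "\<And>g :: 'a \<Rightarrow> real. continuous_on UNIV g \<Longrightarrow> (\<lambda>n. integral\<^sup>L (m (u (r n))) g) \<longlonglongrightarrow> integral\<^sup>L \<nu> g"
      by (rule invariant_measures_seq_compact[OF cf cpt, of "\<lambda>n. m (u n)"]) (use inv u0 in auto)
    have JJ: "(\<lambda>n. J (m (u (r n)))) \<longlonglongrightarrow> J \<nu>" unfolding J_def by (rule conv[OF c\<phi>])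
    have low: "J \<mu>\<^sub>\<phi> - P 0 / u (r n) \<le> J (m (u (r n)))" for n
    proof -
      let ?t = "u (r n)"
      have t: "?t > 0" by (simp add: u_def)
      have "?t * J \<mu>\<^sub>\<phi> \<le> P ?t" using VPr[OF \<mu>\<phi> u0] k0[OF \<mu>\<phi>] by (smt (verit))
      also have "\<dots> \<le> P 0 + ?t * J (m ?t)"
        using VPr[OF inv[OF u0[of "r n"]], of 0] by (simp add: P_def[of ?t])
      finally show ?thesis using t by (simp add: field_simps)
    qed
    have "(\<lambda>n. P 0 / u n) \<longlonglongrightarrow> 0"
      unfolding u_def using LIMSEQ_Suc[OF lim_const_over_n[of "P 0"]] .
    then have "(\<lambda>n. P 0 / u (r n)) \<longlonglongrightarrow> 0"
      using LIMSEQ_subseq_LIMSEQ[OF _ r, of "\<lambda>n. P 0 / u n"] by (simp add: o_def)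
    then have "(\<lambda>n. J \<mu>\<^sub>\<phi> - P 0 / u (r n)) \<longlonglongrightarrow> J \<mu>\<^sub>\<phi> - 0"
      by (intro tendsto_diff tendsto_const)
    then have "J \<mu>\<^sub>\<phi> - 0 \<le> J \<nu>"
      by (rule LIMSEQ_le[OF _ JJ]) (use low in auto)
    then have "\<nu> = \<mu>\<^sub>\<phi>" using J\<phi>[OF \<nu>] by (intro J\<phi>_unique[OF \<nu>]) simp
    then have "ks_entropy f \<nu> < ereal a" using assms(7) that by simp
    then have "eventually (\<lambda>n. ks_entropy f (m (u (r n))) < ereal a) sequentially"
      by (intro usc_eventually_less[OF usc _ \<nu> conv]) (use inv u0 in auto)
    then obtain n where "ks_entropy f (m (u (r n))) < ereal a"
      by (auto simp: eventually_sequentially)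
    then show ?thesis using k[OF inv[OF u0]] u0 by auto
  qed
  \<comment> \<open>In a nontrivial decomposition both parts would attain the maximal pressure.\<close>
  have erg: "m t \<in> ergodic_measures f" if t: "t \<ge> 0" for t
  proof (rule extreme_invariant_measure_ergodic[OF cf cpt inv[OF t]])
    fix p q :: real and \<nu>\<^sub>1 \<nu>\<^sub>2
    assume \<nu>: "\<nu>\<^sub>1 \<in> invariant_measures f" "\<nu>\<^sub>2 \<in> invariant_measures f"
      and pq: "0 < p" "0 < q" "p + q = 1"
      and meas: "\<And>A. A \<in> sets borel \<Longrightarrow> measure (m t) A = p * measure \<nu>\<^sub>1 A + q * measure \<nu>\<^sub>2 A"
      and int: "\<And>g :: 'a \<Rightarrow> real. continuous_on UNIV g \<Longrightarrow> integral\<^sup>L (m t) g = p * integral\<^sup>L \<nu>\<^sub>1 g + q * integral\<^sup>L \<nu>\<^sub>2 g"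
    have "ks_entropy f (m t) \<le> ereal p * ks_entropy f \<nu>\<^sub>1 + ereal q * ks_entropy f \<nu>\<^sub>2"
      by (rule ks_entropy_convex_combination_le[OF _ _ _ _ cf pq(1,2) meas])
        (use \<nu> in \<open>auto simp: invariant_measures_def\<close>)
    then have "k (m t) \<le> p * k \<nu>\<^sub>1 + q * k \<nu>\<^sub>2" using k \<nu> inv[OF t] by simp
    moreover have "J (m t) = p * J \<nu>\<^sub>1 + q * J \<nu>\<^sub>2" unfolding J_def by (rule int[OF c\<phi>])
    ultimately have conv: "P t \<le> p * (k \<nu>\<^sub>1 + t * J \<nu>\<^sub>1) + q * (k \<nu>\<^sub>2 + t * J \<nu>\<^sub>2)"
      by (simp add: P_def algebra_simps)
    have split: "P t = p * P t + q * P t" using pq(3) by (simp flip: distrib_right)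
    have "p * (k \<nu>\<^sub>1 + t * J \<nu>\<^sub>1) \<le> p * P t" "q * (k \<nu>\<^sub>2 + t * J \<nu>\<^sub>2) \<le> q * P t"
      using VPr[OF \<nu>(1) t] VPr[OF \<nu>(2) t] pq by simp_all
    then have "p * P t \<le> p * (k \<nu>\<^sub>1 + t * J \<nu>\<^sub>1)" "q * P t \<le> q * (k \<nu>\<^sub>2 + t * J \<nu>\<^sub>2)"
      using conv split by linarith+
    then have "P t \<le> k \<nu>\<^sub>1 + t * J \<nu>\<^sub>1" "P t \<le> k \<nu>\<^sub>2 + t * J \<nu>\<^sub>2" using pq by simp_all
    then show "\<nu>\<^sub>1 = \<nu>\<^sub>2" using eqIr[OF \<nu>(1) t] eqIr[OF \<nu>(2) t] by simp
  qed
  \<comment> \<open>The same argument with the integral of \<open>\<phi>\<close> in place of the pressure.\<close>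
  have erg\<phi>: "\<mu>\<^sub>\<phi> \<in> ergodic_measures f"
  proof (rule extreme_invariant_measure_ergodic[OF cf cpt \<mu>\<phi>])
    fix p q :: real and \<nu>\<^sub>1 \<nu>\<^sub>2
    assume \<nu>: "\<nu>\<^sub>1 \<in> invariant_measures f" "\<nu>\<^sub>2 \<in> invariant_measures f"
      and pq: "0 < p" "0 < q" "p + q = 1"
      and int: "\<And>g :: 'a \<Rightarrow> real. continuous_on UNIV g \<Longrightarrow> integral\<^sup>L \<mu>\<^sub>\<phi> g = p * integral\<^sup>L \<nu>\<^sub>1 g + q * integral\<^sup>L \<nu>\<^sub>2 g"
    have conv: "J \<mu>\<^sub>\<phi> = p * J \<nu>\<^sub>1 + q * J \<nu>\<^sub>2" unfolding J_def by (rule int[OF c\<phi>])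
    have split: "J \<mu>\<^sub>\<phi> = p * J \<mu>\<^sub>\<phi> + q * J \<mu>\<^sub>\<phi>" using pq(3) by (simp flip: distrib_right)
    have "p * J \<nu>\<^sub>1 \<le> p * J \<mu>\<^sub>\<phi>" "q * J \<nu>\<^sub>2 \<le> q * J \<mu>\<^sub>\<phi>"
      using J\<phi>[OF \<nu>(1)] J\<phi>[OF \<nu>(2)] pq by simp_all
    then have "p * J \<nu>\<^sub>1 = p * J \<mu>\<^sub>\<phi>" "q * J \<nu>\<^sub>2 = q * J \<mu>\<^sub>\<phi>"
      using conv split by linarith+
    then have "J \<nu>\<^sub>1 = J \<mu>\<^sub>\<phi>" "J \<nu>\<^sub>2 = J \<mu>\<^sub>\<phi>" using pq by simp_all
    then show "\<nu>\<^sub>1 = \<nu>\<^sub>2" using J\<phi>_unique \<nu> by metis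
  qed
  show ?thesis
    unfolding intermediate_entropy_property_def
  proof (intro allI impI)
    fix a :: real assume a: "0 \<le> a \<and> ereal a < topological_entropy f"
    show "\<exists>\<mu>\<in>ergodic_measures f. ks_entropy f \<mu> = ereal a"
    proof (cases "a = 0")
      case True
      then show ?thesis using erg\<phi> assms(7) by (auto simp: zero_ereal_def)
    next
      case False
      then obtain T where T: "T \<ge> 0" "k (m T) < a" using k_small[of a] a by auto
      have "a < k (m 0)" using a top k[OF inv[of 0]] by simp
      then have "\<exists>t\<ge>0. t \<le> T \<and> k (m t) = a"
        using T by (intro IVT2' continuous_on_subset[OF k_cont]) auto
      then show ?thesis using erg k[OF inv] by blast
    qed
  qed
qed

end
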